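(* Let $0<\alpha<n$, let $\Phi,\Psi$ be Young functions and let $\Phi\in\mathcal{Y}$. Consider the condition: there exists a constant $C>0$ such that $$r^{-\frac{\alpha}{n}}\,\Phi^{-1}(r)\le C\,\Psi^{-1}(r)\qquad\text{for all } r>0. \qquad ( * )$$ Then $( * )$ is necessary and sufficient for the boundedness of the fractional maximal operator $M_\alpha$ from $L^{\Phi}(\mathbb{R}^n)$ to $WL^{\Psi}(\mathbb{R}^n)$. Moreover, if $\Phi\in\nabla_2$, then $( * )$ is necessary and sufficient for the boundedness of $M_\alpha$ from $L^{\Phi}(\mathbb{R}^n)$ to $L^{\Psi}(\mathbb{R}^n)$.
   Context: A Young function is a convex, left-continuous function $\Phi:[0,\infty)\to[0,\infty]$ with $\lim_{r\to0+}\Phi(r)=\Phi(0)=0$ and $\lim_{r\to\infty}\Phi(r)=\infty$. $\mathcal{Y}$ is the set of Young functions with $0<\Phi(r)<\infty$ for all $0<r<\infty$. For a Young function, $\Phi^{-1}(s)=\inf\{r\ge0:\Phi(r)>s\}$. $\Phi\in\nabla_2$ means that there is $C>1$ with $\Phi(r)\le\frac{1}{2C}\Phi(Cr)$ for all $r\ge0$. The Orlicz space $L^\Phi(\mathbb{R}^n)$ is the set of $f\in L^1_{\rm loc}(\mathbb{R}^n)$ with $\int_{\mathbb{R}^n}\Phi(k|f(x)|)\,dx<\infty$ for some $k>0$, with norm $\|f\|_{L^\Phi}=\inf\{\lambda>0:\int_{\mathbb{R}^n}\Phi(|f(x)|/\lambda)\,dx\le1\}$. The weak Orlicz space $WL^\Phi(\mathbb{R}^n)$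 is the set of $f\in L^1_{\rm loc}(\mathbb{R}^n)$ with $\|f\|_{WL^\Phi}<\infty$, where $\|f\|_{WL^\Phi}=\inf\{\lambda>0:\sup_{t>0}\Phi(t)\,|\{x\in\mathbb{R}^n:|f(x)|/\lambda>t\}|\le1\}$ ($|E|$ is Lebesgue measure; $\infty\cdot0=0$). The fractional maximal operator is $M_\alpha f(x)=\sup_{B\ni x}|B|^{-1+\frac{\alpha}{n}}\int_B|f(y)|\,dy$, the supremum being over all balls $B\subset\mathbb{R}^n$ containing $x$. An operator $T$ is bounded from $X$ to $Y$ if there is a constant $C$ with $\|Tf\|_Y\le C\|f\|_X$ for all $f\in X$. *)

theory Defs
  imports "HOL-Analysis.Analysis"
begin

text \<open>
  A function on \<open>[0,\<infinity>)\<close> with values in \<open>[0,\<infinity>]\<close> is a function of type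
  \<^typ>\<open>real \<Rightarrow> ennreal\<close> whose values at negative arguments are never used.
\<close>

definition young_function :: "(real \<Rightarrow> ennreal) \<Rightarrow> bool" where
  "young_function \<Phi> \<longleftrightarrow>
     (\<forall>r\<ge>0. \<forall>s\<ge>0. \<forall>t\<in>{0..1}.
        \<Phi> (t * r + (1 - t) * s) \<le> ennreal t * \<Phi> r + ennreal (1 - t) * \<Phi> s) \<and>
     (\<forall>r>0. (\<Phi> \<longlongrightarrow> \<Phi> r) (at_left r)) \<and>
     \<Phi> 0 = 0 \<and> (\<Phi> \<longlongrightarrow> 0) (at_right 0) \<and>
     (\<Phi> \<longlongrightarrow> \<infinity>) at_top"

definition young_class_Y :: "(real \<Rightarrow> ennreal) set" where
  "young_class_Y = {\<Phi>. young_function \<Phi> \<and> (\<forall>r>0. 0 < \<Phi> r \<and> \<Phi> r < \<infinity>)}"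

definition young_inverse :: "(real \<Rightarrow> ennreal) \<Rightarrow> real \<Rightarrow> real" where
  "young_inverse \<Phi> s = Inf {r. r \<ge> 0 \<and> \<Phi> r > ennreal s}"

definition nabla2 :: "(real \<Rightarrow> ennreal) \<Rightarrow> bool" where
  "nabla2 \<Phi> \<longleftrightarrow> (\<exists>C>1. \<forall>r\<ge>0. \<Phi> r \<le> ennreal (1 / (2 * C)) * \<Phi> (C * r))"

definition L1_loc :: "('a::euclidean_space \<Rightarrow> real) set" where
  "L1_loc = {f. \<forall>K. compact K \<longrightarrow> set_integrable lebesgue K f}"

definition orlicz_space :: "(real \<Rightarrow> ennreal) \<Rightarrow> ('a::euclidean_space \<Rightarrow> real) set" where
  "orlicz_space \<Phi> =
     {f \<in> L1_loc. \<exists>k>0. (\<integral>\<^sup>+ x. \<Phi> (k * \<bar>f x\<bar>) \<partial>lebesgue) < \<infinity>}"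

definition orlicz_norm :: "(real \<Rightarrow> ennreal) \<Rightarrow> ('a::euclidean_space \<Rightarrow> real) \<Rightarrow> ennreal" where
  "orlicz_norm \<Phi> f =
     Inf {ennreal \<mu> | \<mu>. \<mu> > 0 \<and> (\<integral>\<^sup>+ x. \<Phi> (\<bar>f x\<bar> / \<mu>) \<partial>lebesgue) \<le> 1}"

definition weak_orlicz_norm :: "(real \<Rightarrow> ennreal) \<Rightarrow> ('a::euclidean_space \<Rightarrow> real) \<Rightarrow> ennreal" where
  "weak_orlicz_norm \<Phi> f =
     Inf {ennreal \<mu> | \<mu>. \<mu> > 0 \<and>
            (SUP t\<in>{0<..}. \<Phi> t * emeasure lebesgue {x. \<bar>f x\<bar> / \<mu> > t}) \<le> 1}"

definition weak_orlicz_space :: "(real \<Rightarrow> ennreal) \<Rightarrow> ('a::euclidean_space \<Rightarrow> real) set" where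
  "weak_orlicz_space \<Phi> = {f \<in> L1_loc. weak_orlicz_norm \<Phi> f < \<infinity>}"

definition frac_maximal :: "real \<Rightarrow> ('a::euclidean_space \<Rightarrow> real) \<Rightarrow> 'a \<Rightarrow> ennreal" where
  "frac_maximal \<alpha> f x =
     (SUP (c, r)\<in>{(c, r). r > 0 \<and> x \<in> ball c r}.
        ennreal (measure lebesgue (ball c r) powr (- 1 + \<alpha> / real DIM('a))) *
        (\<integral>\<^sup>+ y\<in>ball c r. ennreal \<bar>f y\<bar> \<partial>lebesgue))"

text \<open>
  The operators considered here take values in \<open>[0,\<infinity>]\<close>. As elements of the target space are
  real-valued and determined up to null sets, \<open>T f \<in> Y\<close> means that \<open>T f\<close> is finite almost
  everywhere and that its real-valued version lies in \<open>Y\<close>. The almost-everywhere clause is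
  essential, since \<^const>\<open>enn2real\<close> maps \<open>\<infinity>\<close> to \<open>0\<close>.
\<close>

definition bounded_operator ::
  "('a::euclidean_space \<Rightarrow> real) set \<Rightarrow> (('a \<Rightarrow> real) \<Rightarrow> ennreal) \<Rightarrow>
   ('a \<Rightarrow> real) set \<Rightarrow> (('a \<Rightarrow> real) \<Rightarrow> ennreal) \<Rightarrow>
   (('a \<Rightarrow> real) \<Rightarrow> 'a \<Rightarrow> ennreal) \<Rightarrow> bool" where
  "bounded_operator X normX Y normY T \<longleftrightarrow>
     (\<exists>C>0. \<forall>f\<in>X.
        (AE x in lebesgue. T f x < \<infinity>) \<and>
        (\<lambda>x. enn2real (T f x)) \<in> Y \<and>
        normY (\<lambda>x. enn2real (T f x)) \<le> ennreal C * normX f)"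

end

theory Submission
  imports Defs
begin

text \<open>
  Weak type: let \<open>\<integral> \<Phi>(|f|) \<le> 1\<close>, let \<open>B\<close> be a ball, and let \<open>A\<close> be the mean of \<open>\<Phi>(|f|)\<close> over
  \<open>B\<close>. Convexity bounds the mean of \<open>|f|\<close> by a multiple of \<open>\<Phi>\<^sup>-\<^sup>1(A)\<close>, and \<open>A \<le> 1/|B|\<close>, so
  \<open>|B|\<^bsup>\<alpha>/n\<^esup>\<close> times this mean is at most a multiple of \<open>A\<^bsup>-\<alpha>/n\<^esup> \<Phi>\<^sup>-\<^sup>1(A) \<le> C \<Psi>\<^sup>-\<^sup>1(A)\<close>. Hence
  \<open>\<Psi>(t) \<le> A\<close> for some ball around each point where \<open>M\<^sub>\<alpha> f\<close> exceeds a multiple of \<open>t\<close>, and the Vitali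
  covering lemma applies.

  Strong type: comparing the mean of \<open>|f|\<close> over \<open>B\<close> with both \<open>M f\<close> and \<open>\<Phi>\<^sup>-\<^sup>1(1/|B|)\<close> gives
  \<open>\<Psi>(M\<^sub>\<alpha> f / c) \<le> \<Phi>(M f)\<close> pointwise, where \<open>M = M\<^sub>0\<close> is the Hardy-Littlewood operator; under \<open>\<nabla>\<^sub>2\<close>
  the operator \<open>M\<close> is bounded on \<open>L\<^sup>\<Phi>\<close> by summing its weak-type estimate over geometric levels.

  Local integrability of \<open>M\<^sub>\<alpha> f\<close> is part of membership in the target spaces: near a compact set,
  large balls contribute at most a multiple of \<open>M\<^sub>\<alpha> f(x\<^sub>0)\<close> for any fixed \<open>x\<^sub>0\<close>, and small balls only see an
  integrable part of \<open>f\<close>, which \<open>M\<^sub>\<alpha>\<close> maps to weak \<open>L\<^sup>p\<close> with \<open>p = n/(n - \<alpha>) > 1\<close>.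

  Necessity: test on indicators of balls.
\<close>

subsection \<open>Young functions\<close>

text \<open>Convexity between \<open>r\<close> and 0, where \<Phi> vanishes. Monotonicity and every
  rescaling of a modular below rest on it.\<close>

lemma young_scale:
  assumes "young_function \<Phi>" "0 \<le> t" "t \<le> 1" "0 \<le> r"
  shows "\<Phi> (t * r) \<le> ennreal t * \<Phi> r"
proof -
  have "\<Phi> (t * r + (1 - t) * 0) \<le> ennreal t * \<Phi> r + ennreal (1 - t) * \<Phi> 0"
    using assms unfolding young_function_def by (metis atLeastAtMost_iff order_refl)
  then show ?thesis
    using assms(1) by (simp add: young_function_def)
qed

lemma young_mono:
  assumes "young_function \<Phi>" "0 \<le> r" "r \<le> s"
  shows "\<Phi> r \<le> \<Phi> s"
proof (cases "s = 0")
  case False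
  with assms have "0 < s" by simp
  then have "\<Phi> (r / s * s) \<le> ennreal (r / s) * \<Phi> s"
    using assms by (intro young_scale) auto
  also have "\<dots> \<le> 1 * \<Phi> s"
    using assms \<open>0 < s\<close> by (intro mult_right_mono) (auto simp: ennreal_le_1)
  finally show ?thesis
    using \<open>0 < s\<close> by simp
qed (use assms in simp)

text \<open>Divergence at infinity supplies an element; together with the lower bound 0 this makes
  the real-valued \<open>Inf\<close> in \<open>young_inverse\<close> a genuine infimum.\<close>

lemma young_inverse_nonempty:
  assumes "young_function \<Phi>"
  shows "{r. r \<ge> 0 \<and> \<Phi> r > ennreal s} \<noteq> {}"
proof -
  have "(\<Phi> \<longlongrightarrow> \<infinity>) at_top"
    using assms by (simp add: young_function_def)
  then have "\<forall>\<^sub>F r in at_top. ennreal s < \<Phi> r"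
    by (rule order_tendstoD) simp
  then have "\<forall>\<^sub>F r in at_top. ennreal s < \<Phi> r \<and> 0 \<le> r"
    using eventually_ge_at_top by (rule eventually_conj)
  then show ?thesis
    using eventually_happens[of _ "at_top :: real filter"] by fastforce
qed

lemma young_inverse_greatest:
  assumes "young_function \<Phi>" "\<And>r. 0 \<le> r \<Longrightarrow> ennreal s < \<Phi> r \<Longrightarrow> m \<le> r"
  shows "m \<le> young_inverse \<Phi> s"
  unfolding young_inverse_def
  using young_inverse_nonempty[OF assms(1)] assms(2) by (intro cInf_greatest) auto

text \<open>Strictly below the infimum no point can exceed the level. The strictness here and in the
  converse bound is the source of the factors 2 and 1/2 attached to \<open>young_inverse\<close>
  later.\<close>

lemma young_le_of_less_inverse:
  assumes "0 \<le> t" "t < young_inverse \<Phi> s"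
  shows "\<Phi> t \<le> ennreal s"
proof (rule ccontr)
  assume "\<not> \<Phi> t \<le> ennreal s"
  then have "young_inverse \<Phi> s \<le> t"
    unfolding young_inverse_def using assms
    by (intro cInf_lower) (auto intro: bdd_belowI[of _ 0])
  with assms show False by simp
qed

lemma young_ge_of_inverse_less:
  assumes "young_function \<Phi>" "young_inverse \<Phi> s < t"
  shows "ennreal s \<le> \<Phi> t"
proof -
  obtain r where r: "0 \<le> r" "ennreal s < \<Phi> r" "r < t"
    using cInf_lessD[OF young_inverse_nonempty[OF assms(1)]] assms(2)
    unfolding young_inverse_def by blast
  then have "\<Phi> r \<le> \<Phi> t"
    using assms(1) by (intro young_mono) auto
  with r show ?thesis by simp
qed

text \<open>Since \<Phi> tends to 0 at 0, it stays below \<open>s\<close> on some interval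
  \<open>(0, b)\<close>, and \<open>b\<close> then bounds the infimum from below.\<close>

lemma young_inverse_pos:
  assumes "young_function \<Phi>" "0 < s"
  shows "0 < young_inverse \<Phi> s"
proof -
  have "(\<Phi> \<longlongrightarrow> 0) (at_right 0)"
    using assms by (simp add: young_function_def)
  then have "\<forall>\<^sub>F r in at_right 0. \<Phi> r < ennreal s"
    using assms(2) by (intro order_tendstoD) auto
  then obtain b where b: "b > 0" "\<And>r. 0 < r \<Longrightarrow> r < b \<Longrightarrow> \<Phi> r < ennreal s"
    unfolding eventually_at_right_field by blast
  have "b \<le> young_inverse \<Phi> s"
    using assms(1)
  proof (rule young_inverse_greatest)
    fix r assume r: "0 \<le> r" "ennreal s < \<Phi> r"
    then have "r \<noteq> 0"
      using assms(1) by (auto simp: young_function_def)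
    with r b(2)[of r] show "b \<le> r" by force
  qed
  with b show ?thesis by simp
qed

lemma young_inverse_mono:
  assumes "young_function \<Phi>" "s \<le> t"
  shows "young_inverse \<Phi> s \<le> young_inverse \<Phi> t"
  using assms(1)
proof (rule young_inverse_greatest)
  fix r assume "0 \<le> r" "ennreal t < \<Phi> r"
  moreover have "ennreal s \<le> ennreal t"
    using assms(2) by (rule ennreal_leI)
  ultimately show "young_inverse \<Phi> s \<le> r"
    unfolding young_inverse_def
    by (intro cInf_lower) (auto intro: bdd_belowI[of _ 0])
qed

lemma le_young_inverse:
  assumes "young_function \<Phi>" "\<Phi> m \<le> ennreal s"
  shows "m \<le> young_inverse \<Phi> s"
  using assms(1)
proof (rule young_inverse_greatest)
  fix r assume r: "0 \<le> r" "ennreal s < \<Phi> r"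
  show "m \<le> r"
  proof (rule ccontr)
    assume "\<not> m \<le> r"
    then have "\<Phi> r \<le> \<Phi> m"
      using assms(1) r by (intro young_mono) auto
    with r assms(2) show False
      by (meson leD order_less_le_trans order_trans)
  qed
qed

lemma young_class_Y_D:
  assumes "\<Phi> \<in> young_class_Y"
  shows "young_function \<Phi>" "\<And>r. 0 < r \<Longrightarrow> 0 < \<Phi> r" "\<And>r. 0 \<le> r \<Longrightarrow> \<Phi> r < \<infinity>"
proof -
  show "young_function \<Phi>" and "\<And>r. 0 < r \<Longrightarrow> 0 < \<Phi> r"
    using assms by (auto simp: young_class_Y_def)
  then show "0 \<le> r \<Longrightarrow> \<Phi> r < \<infinity>" for r
    using assms by (cases "r = 0") (auto simp: young_class_Y_def young_function_def)
qed

text \<open>A monotone real function is Borel. Clipping at 0 avoids the unspecified values at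
  negative arguments, and \<open>enn2real\<close> loses nothing because \<Phi> is finite on
  \<open>young_class_Y\<close>.\<close>

lemma young_comp_measurable:
  assumes "\<Phi> \<in> young_class_Y" "g \<in> borel_measurable M" "\<And>x. 0 \<le> g x"
  shows "(\<lambda>x. \<Phi> (g x)) \<in> borel_measurable M"
proof -
  define \<phi> where "\<phi> x = enn2real (\<Phi> (max 0 x))" for x
  have "mono \<phi>"
    unfolding \<phi>_def using young_class_Y_D[OF assms(1)]
    by (intro monoI enn2real_mono young_mono) auto
  then have [measurable]: "\<phi> \<in> borel_measurable borel"
    by (rule borel_measurable_mono)
  have "\<Phi> (g x) = ennreal (\<phi> (g x))" for x
    using young_class_Y_D(3)[OF assms(1), of "g x"] assms(3)[of x] by (simp add: \<phi>_def max_absorb2)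
  then show ?thesis
    using assms(2) by simp
qed

subsection \<open>A weak-type covering estimate\<close>

lemma measure_lebesgue_ball:
  fixes c :: "'a::euclidean_space"
  assumes "0 < r"
  shows "measure lebesgue (ball c r) = unit_ball_vol (real DIM('a)) * r ^ DIM('a)"
  using assms content_ball[of r c] by simp

lemma measure_lebesgue_ball_pos:
  fixes c :: "'a::euclidean_space"
  assumes "0 < r"
  shows "0 < measure lebesgue (ball c r)"
  using assms by (simp only: measure_lebesgue_ball) simp

lemma emeasure_lebesgue_ball:
  fixes c :: "'a::euclidean_space"
  shows "emeasure lebesgue (ball c r) = ennreal (measure lebesgue (ball c r))"
  using emeasure_lborel_ball_finite[of c r] by (intro emeasure_eq_ennreal_measure) simp

lemma measure_lebesgue_ball_scale:
  fixes c d :: "'a::euclidean_space"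
  assumes "0 < r" "0 < k"
  shows "measure lebesgue (ball d (k * r)) = k ^ DIM('a) * measure lebesgue (ball c r)"
  using assms by (simp only: measure_lebesgue_ball mult_pos_pos power_mult_distrib) simp

lemma exists_ball_measure:
  fixes c :: "'a::euclidean_space"
  assumes "0 < v"
  obtains r where "0 < r" "measure lebesgue (ball c r) = v"
proof -
  define w where "w = unit_ball_vol (real DIM('a))"
  have w: "0 < w" by (simp add: w_def)
  show thesis
  proof
    show "0 < root DIM('a) (v / w)"
      using assms w by (simp add: real_root_gt_zero)
    then have "measure lebesgue (ball c (root DIM('a) (v / w))) = w * root DIM('a) (v / w) ^ DIM('a)"
      unfolding w_def by (rule measure_lebesgue_ball)
    also have "\<dots> = v"
      using assms w by simp
    finally show "measure lebesgue (ball c (root DIM('a) (v / w))) = v" .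
  qed
qed

text \<open>Replaces a positive extended real, possibly infinite, by a positive real so that real
  arithmetic applies.\<close>

lemma ennreal_pos_lower_real:
  assumes "0 < u"
  obtains e where "0 < e" "ennreal e \<le> u"
  using assms by (cases u) (auto intro: that[of 1])

text \<open>Countable subadditivity as an integral over the counting measure, so that a countable
  set of centre-radius pairs can serve as index set without an enumeration.\<close>

lemma emeasure_UN_le_count_space:
  assumes "countable I" and [measurable]: "\<And>i. i \<in> I \<Longrightarrow> X i \<in> sets M"
  shows "emeasure M (\<Union>i\<in>I. X i) \<le> (\<integral>\<^sup>+i. emeasure M (X i) \<partial>count_space I)"
proof -
  have [measurable]: "(\<Union>i\<in>I. X i) \<in> sets M"
    using assms by auto
  have le: "indicator (\<Union>i\<in>I. X i) x \<le> (\<integral>\<^sup>+i. indicator (X i) x \<partial>count_space I)" for x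
  proof (cases "x \<in> (\<Union>i\<in>I. X i)")
    case True
    then obtain j where j: "j \<in> I" "x \<in> X j" by auto
    have "(1::ennreal) = (\<integral>\<^sup>+i. indicator {j} i \<partial>count_space I)"
      using j by (subst nn_integral_indicator) auto
    also have "\<dots> \<le> (\<integral>\<^sup>+i. indicator (X i) x \<partial>count_space I)"
      using j by (intro nn_integral_mono) (auto split: split_indicator)
    finally show ?thesis
      using True by simp
  qed simp
  have "emeasure M (\<Union>i\<in>I. X i) = (\<integral>\<^sup>+x. indicator (\<Union>i\<in>I. X i) x \<partial>M)"
    by simp
  also have "\<dots> \<le> (\<integral>\<^sup>+x. \<integral>\<^sup>+i. indicator (X i) x \<partial>count_space I \<partial>M)"
    by (intro nn_integral_mono le)
  also have "\<dots> = (\<integral>\<^sup>+i. \<integral>\<^sup>+x. indicator (X i) x \<partial>M \<partial>count_space I)"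
    using assms by (intro nn_integral_count_space_nn_integral) auto
  also have "\<dots> = (\<integral>\<^sup>+i. emeasure M (X i) \<partial>count_space I)"
    using assms by (intro nn_integral_cong) auto
  finally show ?thesis .
qed

text \<open>Vitali selection: disjoint balls whose fivefold enlargements cover \<open>S\<close> cost
  a factor \<open>5 ^ DIM('a)\<close>, and on disjoint balls the integrals of \<open>g\<close> add
  up to at most its total. \<open>S\<close> itself may be non-measurable, since monotonicity is
  applied with the measurable union on the right.\<close>

lemma Vitali_weak_type:
  fixes g :: "'a::euclidean_space \<Rightarrow> ennreal"
  assumes g[measurable]: "g \<in> borel_measurable lebesgue"
    and cover: "\<And>x. x \<in> S \<Longrightarrow> \<exists>c r. 0 < r \<and> x \<in> ball c r \<and>
        s * emeasure lebesgue (ball c r) \<le> (\<integral>\<^sup>+y\<in>ball c r. g y \<partial>lebesgue)"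
  shows "s * emeasure lebesgue S \<le> 5 ^ DIM('a) * (\<integral>\<^sup>+y. g y \<partial>lebesgue)"
proof (cases "s = 0 \<or> (\<integral>\<^sup>+y. g y \<partial>lebesgue) = \<infinity>")
  case True
  then show ?thesis by (auto simp: ennreal_mult_top)
next
  case False
  define G where "G = (\<integral>\<^sup>+y. g y \<partial>lebesgue)"
  define K where "K = {(c :: 'a, r). 0 < r \<and>
      s * emeasure lebesgue (ball c r) \<le> (\<integral>\<^sup>+y\<in>ball c r. g y \<partial>lebesgue)}"
  define w where "w = unit_ball_vol (real DIM('a))"
  have w: "0 < w" by (simp add: w_def)
  have G: "G < \<infinity>" and s: "0 < s"
    using False by (auto simp: G_def less_top zero_less_iff_neq_zero)
  obtain s' where s': "0 < s'" "ennreal s' \<le> s"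
    using s by (rule ennreal_pos_lower_real)
  \<comment> \<open>The covering lemma needs uniformly bounded radii. Finiteness of \<open>G\<close>
    bounds the volume of every ball in \<open>K\<close>; \<open>s'\<close> stands in for
    \<open>s\<close>, which may be infinite.\<close>
  obtain B where B: "\<And>c r. (c, r) \<in> K \<Longrightarrow> r \<le> B"
  proof
    fix c r assume "(c, r) \<in> K"
    then have r: "0 < r" and le: "s * emeasure lebesgue (ball c r) \<le> (\<integral>\<^sup>+y\<in>ball c r. g y \<partial>lebesgue)"
      by (auto simp: K_def)
    have "(\<integral>\<^sup>+y\<in>ball c r. g y \<partial>lebesgue) \<le> G"
      unfolding G_def by (intro nn_integral_mono) (auto split: split_indicator)
    with le have "s * ennreal (w * r ^ DIM('a)) \<le> G"
      using r by (simp only: emeasure_lebesgue_ball measure_lebesgue_ball w_def)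
    moreover have "ennreal s' * ennreal (w * r ^ DIM('a)) \<le> s * ennreal (w * r ^ DIM('a))"
      using s' by (intro mult_right_mono) auto
    ultimately have "ennreal (s' * (w * r ^ DIM('a))) \<le> ennreal (enn2real G)"
      using s' w r G by (simp add: ennreal_mult)
    then have "s' * (w * r ^ DIM('a)) \<le> enn2real G"
      by (simp add: ennreal_le_iff)
    then have "r ^ DIM('a) \<le> enn2real G / (s' * w)"
      using w s' by (simp add: field_simps)
    \<comment> \<open>Turns the bound on the volume into one on the radius without taking
      roots.\<close>
    moreover have "r \<le> max 1 (r ^ DIM('a))"
      using r by (cases "r \<le> 1") (auto intro!: self_le_power simp: max_def)
    ultimately show "r \<le> max 1 (enn2real G / (s' * w))"
      by linarith
  qed
  have "S \<subseteq> (\<Union>i\<in>K. ball (fst i) (snd i))"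
    using cover by (force simp: K_def)
  moreover have "\<And>i. i \<in> K \<Longrightarrow> 0 < snd i \<and> snd i \<le> B"
    using B by (auto simp: K_def)
  ultimately obtain C where C: "countable C" "C \<subseteq> K"
      "pairwise (\<lambda>i j. disjnt (ball (fst i) (snd i)) (ball (fst j) (snd j))) C"
      "S \<subseteq> (\<Union>i\<in>C. ball (fst i) (5 * snd i))"
    by (rule Vitali_covering_lemma_balls)
  have disj: "disjoint_family_on (\<lambda>i. ball (fst i) (snd i)) C"
    using C(3) by (auto simp: disjoint_family_on_def pairwise_def disjnt_def)
  have "s * emeasure lebesgue S \<le> s * emeasure lebesgue (\<Union>i\<in>C. ball (fst i) (5 * snd i))"
    using C(1,4) by (intro mult_left_mono emeasure_mono sets.countable_UN'') auto
  also have "\<dots> \<le> s * (\<integral>\<^sup>+i. emeasure lebesgue (ball (fst i) (5 * snd i)) \<partial>count_space C)"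
    using C(1) by (intro mult_left_mono emeasure_UN_le_count_space) auto
  also have "\<dots> = 5 ^ DIM('a) * (\<integral>\<^sup>+i. s * emeasure lebesgue (ball (fst i) (snd i)) \<partial>count_space C)"
  proof -
    have "emeasure lebesgue (ball (fst i) (5 * snd i)) = 5 ^ DIM('a) * emeasure lebesgue (ball (fst i) (snd i))"
      if "i \<in> C" for i
    proof -
      have "0 < snd i" using that C(2) by (auto simp: K_def)
      then have "measure lebesgue (ball (fst i) (5 * snd i)) = 5 ^ DIM('a) * measure lebesgue (ball (fst i) (snd i))"
        by (intro measure_lebesgue_ball_scale) auto
      then show ?thesis
        unfolding emeasure_lebesgue_ball
        by (simp only: ennreal_mult measure_nonneg zero_le_power zero_le_numeral)
           (simp only: flip: ennreal_power ennreal_numeral)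
    qed
    then have "(\<integral>\<^sup>+i. emeasure lebesgue (ball (fst i) (5 * snd i)) \<partial>count_space C)
        = (\<integral>\<^sup>+i. 5 ^ DIM('a) * emeasure lebesgue (ball (fst i) (snd i)) \<partial>count_space C)"
      by (intro nn_integral_cong) auto
    then show ?thesis
      by (simp add: nn_integral_cmult mult.left_commute)
  qed
  \<comment> \<open>Reading the integrals of \<open>g\<close> as values of the measure with density
    \<open>g\<close> lets countable additivity sum them over the disjoint balls.\<close>
  also have "\<dots> \<le> 5 ^ DIM('a) * (\<integral>\<^sup>+i. emeasure (density lebesgue g) (ball (fst i) (snd i)) \<partial>count_space C)"
    using C(2) by (intro mult_left_mono nn_integral_mono) (auto simp: K_def emeasure_density)
  also have "\<dots> = 5 ^ DIM('a) * emeasure (density lebesgue g) (\<Union>i\<in>C. ball (fst i) (snd i))"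
    using C(1) disj by (subst emeasure_UN_countable) auto
  also have "\<dots> \<le> 5 ^ DIM('a) * emeasure (density lebesgue g) (space (density lebesgue g))"
    by (intro mult_left_mono emeasure_space) auto
  also have "\<dots> = 5 ^ DIM('a) * G"
    by (simp add: emeasure_density G_def)
  finally show ?thesis
    by (simp add: G_def)
qed

subsection \<open>The weak-type inequality for the fractional maximal operator\<close>

lemma ball_in_sets_lebesgue[measurable]: "ball c r \<in> sets lebesgue"
  for c :: "'a::euclidean_space"
  by simp

lemma powr_average:
  fixes V :: real
  assumes "0 < V"
  shows "V powr (b - 1) * V = V powr b"
  using assms by (simp add: powr_diff)

section \<open>Elementary properties of \<open>frac_maximal\<close>\<close>

lemma frac_maximal_ge:
  fixes f :: "'a::euclidean_space \<Rightarrow> real"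
  assumes "0 < r" "x \<in> ball c r"
  shows "ennreal (measure lebesgue (ball c r) powr (- 1 + \<alpha> / real DIM('a))) *
      (\<integral>\<^sup>+ y\<in>ball c r. ennreal \<bar>f y\<bar> \<partial>lebesgue) \<le> frac_maximal \<alpha> f x"
  unfolding frac_maximal_def using assms by (intro SUP_upper2[of "(c, r)"]) auto

lemma frac_maximal_le:
  fixes f :: "'a::euclidean_space \<Rightarrow> real"
  assumes "\<And>c r. 0 < r \<Longrightarrow> x \<in> ball c r \<Longrightarrow>
      ennreal (measure lebesgue (ball c r) powr (- 1 + \<alpha> / real DIM('a))) *
      (\<integral>\<^sup>+ y\<in>ball c r. ennreal \<bar>f y\<bar> \<partial>lebesgue) \<le> u"
  shows "frac_maximal \<alpha> f x \<le> u"
  unfolding frac_maximal_def using assms by (intro SUP_least) auto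

lemma less_frac_maximalE:
  fixes f :: "'a::euclidean_space \<Rightarrow> real"
  assumes "t < frac_maximal \<alpha> f x"
  obtains c r where "0 < r" "x \<in> ball c r"
    "t < ennreal (measure lebesgue (ball c r) powr (- 1 + \<alpha> / real DIM('a))) *
      (\<integral>\<^sup>+ y\<in>ball c r. ennreal \<bar>f y\<bar> \<partial>lebesgue)"
  using assms unfolding frac_maximal_def less_SUP_iff by auto

text \<open>Lower semicontinuity: the supremum is uncentred, so a ball witnessing a large value at
  \<open>x\<close> witnesses it at each of its points, and superlevel sets are open.\<close>

lemma frac_maximal_measurable[measurable]:
  fixes f :: "'a::euclidean_space \<Rightarrow> real"
  shows "frac_maximal \<alpha> f \<in> borel_measurable borel"
proof (rule borel_measurableI_greater)
  fix t
  have "open {x. t < frac_maximal \<alpha> f x}"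
    unfolding open_contains_ball
  proof
    fix x assume "x \<in> {x. t < frac_maximal \<alpha> f x}"
    then obtain c r where *: "0 < r" "x \<in> ball c r"
        "t < ennreal (measure lebesgue (ball c r) powr (- 1 + \<alpha> / real DIM('a))) *
          (\<integral>\<^sup>+ y\<in>ball c r. ennreal \<bar>f y\<bar> \<partial>lebesgue)"
      by (auto elim: less_frac_maximalE)
    then have "ball c r \<subseteq> {x. t < frac_maximal \<alpha> f x}"
      by (auto intro: less_le_trans[OF *(3) frac_maximal_ge])
    with *(2) show "\<exists>e>0. ball x e \<subseteq> {x. t < frac_maximal \<alpha> f x}"
      by (meson open_ball open_contains_ball order_trans)
  qed
  then show "{x \<in> space borel. t < frac_maximal \<alpha> f x} \<in> sets borel"
    by simp
qed

lemma frac_maximal_measurable_lebesgue[measurable]: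
  "frac_maximal \<alpha> f \<in> borel_measurable lebesgue"
  using frac_maximal_measurable[of \<alpha> f] by (intro measurable_completion) simp

lemma frac_maximal_cmult:
  fixes f :: "'a::euclidean_space \<Rightarrow> real"
  assumes [measurable]: "f \<in> borel_measurable lebesgue" and "0 \<le> k"
  shows "frac_maximal \<alpha> (\<lambda>x. k * f x) x = ennreal k * frac_maximal \<alpha> f x"
proof -
  have "(\<integral>\<^sup>+ y\<in>ball c r. ennreal \<bar>k * f y\<bar> \<partial>lebesgue) =
      ennreal k * (\<integral>\<^sup>+ y\<in>ball c r. ennreal \<bar>f y\<bar> \<partial>lebesgue)" for c r
    using assms(2)
    by (subst nn_integral_cmult[symmetric]) (auto simp: abs_mult ennreal_mult mult.assoc)
  then show ?thesis
    unfolding frac_maximal_def SUP_mult_left_ennreal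
    by (intro SUP_cong) (auto simp: mult.left_commute)
qed

text \<open>\<open>f\<close> is the pointwise limit of its truncations to growing closed balls, each
  of which is integrable.\<close>

lemma L1_loc_measurable:
  fixes f :: "'a::euclidean_space \<Rightarrow> real"
  assumes "f \<in> L1_loc"
  shows "f \<in> borel_measurable lebesgue"
proof (rule borel_measurable_LIMSEQ_real)
  show "(\<lambda>x. indicator (cball 0 (real i)) x *\<^sub>R f x) \<in> borel_measurable lebesgue" for i
    using assms by (auto simp: L1_loc_def set_integrable_def intro: borel_measurable_integrable)
  show "(\<lambda>i. indicator (cball 0 (real i)) x *\<^sub>R f x) \<longlonglongrightarrow> f x" for x
  proof (rule tendsto_eventually)
    obtain N :: nat where "norm x \<le> real N"
      using real_arch_simple by blast
    then show "\<forall>\<^sub>F i in sequentially. indicator (cball 0 (real i)) x *\<^sub>R f x = f x"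
      by (intro eventually_sequentiallyI[of N]) auto
  qed
qed

text \<open>
  A substitute for Jensen's inequality: convexity gives
  \<open>s \<le> \<lambda> + \<lambda> \<Phi> s / \<Phi> \<lambda>\<close> for all \<open>s \<ge> 0\<close>, used here with \<open>\<lambda> = 2 \<Phi>\<^sup>-\<^sup>1(A)\<close>.
\<close>

lemma ball_integral_le_young_inverse:
  fixes f :: "'a::euclidean_space \<Rightarrow> real"
  assumes Y: "\<Phi> \<in> young_class_Y" and f[measurable]: "f \<in> borel_measurable lebesgue"
    and A: "0 < A"
    and le: "(\<integral>\<^sup>+ y\<in>ball c r. \<Phi> \<bar>f y\<bar> \<partial>lebesgue) \<le> ennreal (A * measure lebesgue (ball c r))"
  shows "(\<integral>\<^sup>+ y\<in>ball c r. ennreal \<bar>f y\<bar> \<partial>lebesgue)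
      \<le> ennreal (4 * young_inverse \<Phi> A * measure lebesgue (ball c r))"
proof -
  note Y' = young_class_Y_D[OF Y]
  define V where "V = measure lebesgue (ball c r)"
  define l where "l = 2 * young_inverse \<Phi> A"
  have inv: "0 < young_inverse \<Phi> A"
    using Y'(1) A by (rule young_inverse_pos)
  then have l: "0 < l" by (simp add: l_def)
  have A_le: "ennreal A \<le> \<Phi> l"
    using inv by (intro young_ge_of_inverse_less Y') (simp add: l_def)
  have [measurable]: "(\<lambda>y. \<Phi> \<bar>f y\<bar>) \<in> borel_measurable lebesgue"
    by (rule young_comp_measurable[OF Y]) auto
  have pt: "ennreal s \<le> ennreal l + ennreal (l / A) * \<Phi> s" if "0 \<le> s" for s
  proof (cases "s \<le> l")
    case True
    then have "ennreal s \<le> ennreal l"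
      by (rule ennreal_leI)
    then show ?thesis
      by (rule order_trans) simp
  next
    case False
    then have s: "l < s" "0 < s" using l by auto
    obtain p where p: "\<Phi> s = ennreal p" "0 \<le> p"
      using Y'(3)[of s] s by (cases "\<Phi> s") auto
    \<comment> \<open>Since \<open>l < s\<close>, scaling \<open>s\<close> down by
      \<open>l / s\<close> gives \<open>A \<le> \<Phi> l \<le> (l / s) * \<Phi> s\<close>, hence
      \<open>s \<le> (l / A) * \<Phi> s\<close>; the lower bound \<open>A\<close> takes the place of
      \<open>\<Phi> l\<close>.\<close>
    have "ennreal A \<le> \<Phi> (l / s * s)"
      using A_le s by simp
    also have "\<dots> \<le> ennreal (l / s) * \<Phi> s"
      using s l by (intro young_scale Y') auto
    also have "\<dots> = ennreal (l / s * p)"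
      unfolding p(1) using p(2) s l by (intro ennreal_mult[symmetric]) auto
    finally have "A \<le> l / s * p"
      using p s l by (simp add: ennreal_le_iff)
    then have "s \<le> l / A * p"
      using s A by (simp add: field_simps)
    then have "ennreal s \<le> ennreal (l / A * p)"
      by (rule ennreal_leI)
    also have "\<dots> = ennreal (l / A) * \<Phi> s"
      unfolding p(1) using p(2) l A by (intro ennreal_mult) auto
    finally show ?thesis
      by (rule order_trans) simp
  qed
  have "(\<integral>\<^sup>+ y\<in>ball c r. ennreal \<bar>f y\<bar> \<partial>lebesgue)
      \<le> (\<integral>\<^sup>+ y. ennreal l * indicator (ball c r) y + ennreal (l / A) * (\<Phi> \<bar>f y\<bar> * indicator (ball c r) y) \<partial>lebesgue)"
    using pt by (intro nn_integral_mono) (auto split: split_indicator)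
  also have "\<dots> = ennreal l * emeasure lebesgue (ball c r) + ennreal (l / A) * (\<integral>\<^sup>+ y\<in>ball c r. \<Phi> \<bar>f y\<bar> \<partial>lebesgue)"
    by (subst nn_integral_add) (auto simp: nn_integral_cmult)
  also have "\<dots> \<le> ennreal l * ennreal V + ennreal (l / A) * ennreal (A * V)"
    unfolding emeasure_lebesgue_ball V_def by (intro add_left_mono mult_left_mono le) auto
  also have "\<dots> = ennreal (l * V) + ennreal (l / A * (A * V))"
    using l A by (intro arg_cong2[where f="(+)"] ennreal_mult[symmetric]) (auto simp: V_def)
  also have "\<dots> = ennreal (l * V + l / A * (A * V))"
    using l A by (intro ennreal_plus[symmetric]) (auto simp: V_def)
  \<comment> \<open>Both summands equal \<open>l * V\<close>, that is twice the inverse times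
    \<open>V\<close>; hence the 4.\<close>
  also have "l * V + l / A * (A * V) = 4 * young_inverse \<Phi> A * V"
    using A by (simp add: l_def field_simps)
  finally show ?thesis
    by (simp add: V_def)
qed

text \<open>The right-hand side keeps the modular instead of the bound 1, so that shrinking
  \<open>f\<close> can later absorb the factor \<open>5 ^ DIM('a)\<close>. The value \<alpha> = 0 is
  included for the sake of the Hardy-Littlewood operator.\<close>

lemma frac_maximal_weak_type:
  fixes f :: "'a::euclidean_space \<Rightarrow> real"
  assumes Y: "\<Phi> \<in> young_class_Y" and \<alpha>: "0 \<le> \<alpha>"
    and C: "0 < C" "\<And>r. 0 < r \<Longrightarrow>
      r powr (- \<alpha> / real DIM('a)) * young_inverse \<Phi> r \<le> C * young_inverse \<Psi> r"
    and f[measurable]: "f \<in> borel_measurable lebesgue"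
    and f1: "(\<integral>\<^sup>+ y. \<Phi> \<bar>f y\<bar> \<partial>lebesgue) \<le> 1"
    and t: "0 < t"
  shows "\<Psi> t * emeasure lebesgue {x. ennreal (4 * C * t) < frac_maximal \<alpha> f x}
      \<le> 5 ^ DIM('a) * (\<integral>\<^sup>+ y. \<Phi> \<bar>f y\<bar> \<partial>lebesgue)"
proof (rule Vitali_weak_type)
  note Y' = young_class_Y_D[OF Y]
  show [measurable]: "(\<lambda>y. \<Phi> \<bar>f y\<bar>) \<in> borel_measurable lebesgue"
    by (rule young_comp_measurable[OF Y]) auto
  fix x assume "x \<in> {x. ennreal (4 * C * t) < frac_maximal \<alpha> f x}"
  then obtain c r where r: "0 < r" "x \<in> ball c r" and
    gt: "ennreal (4 * C * t) < ennreal (measure lebesgue (ball c r) powr (- 1 + \<alpha> / real DIM('a))) *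
      (\<integral>\<^sup>+ y\<in>ball c r. ennreal \<bar>f y\<bar> \<partial>lebesgue)"
    by (auto elim: less_frac_maximalE)
  define V where "V = measure lebesgue (ball c r)"
  have V: "0 < V" unfolding V_def using r(1) by (rule measure_lebesgue_ball_pos)
  define J where "J = (\<integral>\<^sup>+ y\<in>ball c r. \<Phi> \<bar>f y\<bar> \<partial>lebesgue)"
  have "J \<le> (\<integral>\<^sup>+ y. \<Phi> \<bar>f y\<bar> \<partial>lebesgue)"
    unfolding J_def by (intro nn_integral_mono) (auto split: split_indicator)
  then have J1: "J \<le> 1" using f1 by simp
  then obtain j where j: "J = ennreal j" "0 \<le> j"
    by (cases J) (auto simp: top_unique)
  with J1 have j1: "j \<le> 1"
    by simp
  \<comment> \<open>A vanishing modular on the ball would force \<open>f = 0\<close> almost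
    everywhere there, as \<Phi> is positive off 0, contradicting \<open>gt\<close>. Positivity of
    the mean \<open>A\<close> is needed to apply the condition at \<open>A\<close>.\<close>
  have "j \<noteq> 0"
  proof
    assume "j = 0"
    then have "AE y in lebesgue. \<Phi> \<bar>f y\<bar> * indicator (ball c r) y = 0"
      using j(1) unfolding J_def by (simp add: nn_integral_0_iff_AE)
    then have "AE y in lebesgue. ennreal \<bar>f y\<bar> * indicator (ball c r) y = 0"
    proof eventually_elim
      case (elim y)
      then show ?case
        using Y'(2)[of "\<bar>f y\<bar>"] by (cases "f y = 0") (auto split: split_indicator_asm)
    qed
    then have "(\<integral>\<^sup>+ y\<in>ball c r. ennreal \<bar>f y\<bar> \<partial>lebesgue) = 0"
      by (subst nn_integral_0_iff_AE) auto
    with gt show False by simp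
  qed
  with j have j0: "0 < j" by simp
  define A where "A = j / V"
  have A: "0 < A" "A * V = j" using j0 V by (auto simp: A_def)
  have "(\<integral>\<^sup>+ y\<in>ball c r. ennreal \<bar>f y\<bar> \<partial>lebesgue) \<le> ennreal (4 * young_inverse \<Phi> A * V)"
    unfolding V_def using A j
    by (intro ball_integral_le_young_inverse[OF Y]) (auto simp: J_def[symmetric] V_def[symmetric])
  with gt have "ennreal (4 * C * t) < ennreal (V powr (- 1 + \<alpha> / real DIM('a))) * ennreal (4 * young_inverse \<Phi> A * V)"
    unfolding V_def by (meson less_le_trans mult_left_mono zero_le)
  also have "\<dots> = ennreal (4 * (V powr (\<alpha> / real DIM('a)) * young_inverse \<Phi> A))"
    using V young_inverse_pos[OF Y'(1) A(1)]
    by (simp add: ennreal_mult[symmetric] powr_average mult.assoc)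
  finally have "C * t < V powr (\<alpha> / real DIM('a)) * young_inverse \<Phi> A"
    using C t by (simp add: ennreal_less_iff)
  also have "\<dots> \<le> A powr (- \<alpha> / real DIM('a)) * young_inverse \<Phi> A"
  proof (rule mult_right_mono)
    have "V \<le> 1 / A"
      \<comment> \<open>The normalisation \<open>j \<le> 1\<close> enters here: it trades the power
        of the volume for a power of the mean \<open>A\<close>.\<close>
      using V j1 j0 by (simp add: A_def field_simps)
    then have "V powr (\<alpha> / real DIM('a)) \<le> (1 / A) powr (\<alpha> / real DIM('a))"
      using V \<alpha> by (intro powr_mono2) auto
    also have "\<dots> = A powr (- \<alpha> / real DIM('a))"
      using A by (simp add: powr_divide powr_minus_divide)
    finally show "V powr (\<alpha> / real DIM('a)) \<le> A powr (- \<alpha> / real DIM('a))" .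
  qed (use young_inverse_pos[OF Y'(1) A(1)] in simp)
  also have "\<dots> \<le> C * young_inverse \<Psi> A"
    using A by (intro C)
  finally have "t < young_inverse \<Psi> A"
    using C by simp
  then have "\<Psi> t \<le> ennreal A"
    using t by (intro young_le_of_less_inverse) auto
  then have "\<Psi> t * emeasure lebesgue (ball c r) \<le> ennreal A * ennreal V"
    unfolding emeasure_lebesgue_ball V_def by (intro mult_right_mono) auto
  also have "\<dots> = J"
    using A V j by (simp add: ennreal_mult[symmetric])
  finally show "\<exists>c r. 0 < r \<and> x \<in> ball c r \<and>
      \<Psi> t * emeasure lebesgue (ball c r) \<le> (\<integral>\<^sup>+ y\<in>ball c r. \<Phi> \<bar>f y\<bar> \<partial>lebesgue)"
    using r unfolding J_def by blast
qed

subsection \<open>Local integrability\<close>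

lemma ennreal_le_divideI:
  assumes "0 < s" "0 \<le> b" "ennreal s * m \<le> ennreal b"
  shows "m \<le> ennreal (b / s)"
proof (cases m)
  case (real x)
  then have "ennreal (s * x) \<le> ennreal b"
    using assms by (simp add: ennreal_mult)
  then have "s * x \<le> b"
    using assms by (simp add: ennreal_le_iff)
  then show ?thesis
    using real assms by (auto intro!: ennreal_leI simp: field_simps)
qed (use assms in \<open>simp add: ennreal_mult_top top_unique\<close>)

text \<open>The exponent satisfies \<open>-1 + \<alpha>/n = -1/p\<close>. A ball of volume
  \<open>V\<close> with integral \<open>i \<le> H\<close> that raises the operator above
  \<open>t\<close> has \<open>t powr p * V \<le> i powr p \<le> i * H powr (p - 1)\<close>, which is
  linear in \<open>i\<close> and thus fits the covering estimate with constant
  \<open>t powr p * H powr (1 - p)\<close>.\<close>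

lemma frac_maximal_weak_Lp:
  fixes h :: "'a::euclidean_space \<Rightarrow> real"
  assumes [measurable]: "h \<in> borel_measurable lebesgue"
    and H: "0 < H" "(\<integral>\<^sup>+ y. ennreal \<bar>h y\<bar> \<partial>lebesgue) \<le> ennreal H"
    and \<alpha>: "0 \<le> \<alpha>" "\<alpha> < real DIM('a)" and t: "0 < t"
  defines "p \<equiv> real DIM('a) / (real DIM('a) - \<alpha>)"
  shows "emeasure lebesgue {x. ennreal t < frac_maximal \<alpha> h x}
      \<le> ennreal (5 ^ DIM('a) * H powr p * t powr (- p))"
proof -
  have p: "1 \<le> p" "- 1 + \<alpha> / real DIM('a) = - 1 / p"
    using \<alpha> by (auto simp: p_def field_simps)
  have "ennreal (t powr p * H powr (1 - p)) * emeasure lebesgue {x. ennreal t < frac_maximal \<alpha> h x}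
      \<le> 5 ^ DIM('a) * (\<integral>\<^sup>+ y. ennreal \<bar>h y\<bar> \<partial>lebesgue)"
  proof (rule Vitali_weak_type)
    fix x assume "x \<in> {x. ennreal t < frac_maximal \<alpha> h x}"
    then obtain c r where r: "0 < r" "x \<in> ball c r" and
      gt: "ennreal t < ennreal (measure lebesgue (ball c r) powr (- 1 + \<alpha> / real DIM('a))) *
        (\<integral>\<^sup>+ y\<in>ball c r. ennreal \<bar>h y\<bar> \<partial>lebesgue)"
      by (auto elim: less_frac_maximalE)
    define V where "V = measure lebesgue (ball c r)"
    have V: "0 < V" unfolding V_def using r(1) by (rule measure_lebesgue_ball_pos)
    define I where "I = (\<integral>\<^sup>+ y\<in>ball c r. ennreal \<bar>h y\<bar> \<partial>lebesgue)"
    have "I \<le> (\<integral>\<^sup>+ y. ennreal \<bar>h y\<bar> \<partial>lebesgue)"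
      unfolding I_def by (intro nn_integral_mono) (auto split: split_indicator)
    then have IH: "I \<le> ennreal H" using H by simp
    then obtain i where i: "I = ennreal i" "0 \<le> i"
      by (cases I) (auto simp: top_unique)
    have iH: "i \<le> H"
      using IH i H by (simp add: ennreal_le_iff)
    have "ennreal t < ennreal (V powr (- 1 / p) * i)"
      using gt i unfolding V_def[symmetric] I_def[symmetric] p(2) by (simp add: ennreal_mult)
    then have ti: "t < V powr (- 1 / p) * i"
      using t by (simp add: ennreal_less_iff)
    with t i have i0: "0 < i"
      by (cases "i = 0") auto
    have "t powr p \<le> (V powr (- 1 / p) * i) powr p"
      using ti t p by (intro powr_mono2) auto
    also have "\<dots> = V powr (- 1) * i powr p"
      using p V i by (simp add: powr_mult powr_powr)
    \<comment> \<open>One factor \<open>i\<close> is kept, because the integral over the ball must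
      appear to the first power; only the remaining power is bounded through
      \<open>H\<close>.\<close>
    also have "\<dots> = (i * i powr (p - 1)) / V"
      using V i0 by (simp add: powr_minus powr_diff field_simps)
    also have "\<dots> \<le> (i * H powr (p - 1)) / V"
      using V i0 iH p by (intro divide_right_mono mult_left_mono powr_mono2) auto
    finally have "t powr p * V \<le> i * H powr (p - 1)"
      using V by (simp add: field_simps)
    then have "t powr p * V * H powr (1 - p) \<le> i * H powr (p - 1) * H powr (1 - p)"
      by (rule mult_right_mono) simp
    also have "\<dots> = i"
      using H by (simp add: mult.assoc powr_add[symmetric])
    finally have "ennreal (t powr p * H powr (1 - p) * V) \<le> I"
      unfolding i(1) by (intro ennreal_leI) (simp add: mult_ac)
    then have "ennreal (t powr p * H powr (1 - p)) * emeasure lebesgue (ball c r) \<le> I"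
      unfolding emeasure_lebesgue_ball V_def by (simp add: ennreal_mult)
    with r show "\<exists>c r. 0 < r \<and> x \<in> ball c r \<and>
      ennreal (t powr p * H powr (1 - p)) * emeasure lebesgue (ball c r)
        \<le> (\<integral>\<^sup>+ y\<in>ball c r. ennreal \<bar>h y\<bar> \<partial>lebesgue)"
      unfolding I_def by blast
  qed measurable
  also have "\<dots> \<le> 5 ^ DIM('a) * ennreal H"
    by (intro mult_left_mono H) auto
  also have "\<dots> = ennreal (5 ^ DIM('a) * H)"
    using H by (simp add: ennreal_mult ennreal_power[symmetric])
  finally have "emeasure lebesgue {x. ennreal t < frac_maximal \<alpha> h x}
      \<le> ennreal ((5 ^ DIM('a) * H) / (t powr p * H powr (1 - p)))"
    using t H by (intro ennreal_le_divideI) auto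
  also have "(5 ^ DIM('a) * H) / (t powr p * H powr (1 - p)) = 5 ^ DIM('a) * H powr p * t powr (- p)"
    using t H by (simp add: powr_diff powr_minus field_simps)
  finally show ?thesis .
qed

text \<open>A discrete layer-cake bound: with \<open>k\<close> least such that
  \<open>z \<le> 2 ^ k\<close>, all levels below \<open>k\<close> are exceeded and their sum is
  \<open>2 ^ k - 1\<close>. The summand 1 restores the missing unit and covers values at most
  1.\<close>

lemma ennreal_le_dyadic_sum:
  fixes u :: ennreal
  shows "u \<le> 1 + (\<Sum>k. ennreal (2 ^ k) * indicator {v. ennreal (2 ^ k) < v} u)"
\<comment> \<open>Approximating \<open>u\<close> from below by finite \<open>y\<close> treats
  \<open>u = \<infinity>\<close> together with the finite values.\<close>
proof (rule dense_le)
  fix y assume "y < u"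
  then obtain z where z: "y = ennreal z" "0 \<le> z"
    by (cases y) auto
  show "y \<le> 1 + (\<Sum>k. ennreal (2 ^ k) * indicator {v. ennreal (2 ^ k) < v} u)"
  proof (cases "z \<le> 1")
    case True
    then have "y \<le> 1" using z by simp
    then show ?thesis by (rule order_trans) simp
  next
    case False
    define k where "k = (LEAST k. z \<le> 2 ^ k)"
    have "\<exists>k. z \<le> 2 ^ k"
      using real_arch_pow[of 2 z] by (auto intro: less_imp_le)
    then have k: "z \<le> 2 ^ k" "\<And>j. j < k \<Longrightarrow> 2 ^ j < z"
      unfolding k_def by (auto intro: LeastI dest: not_less_Least)
    have "y \<le> ennreal (1 + (\<Sum>j<k. 2 ^ j))"
      using z k(1) by (auto intro!: ennreal_leI simp: sum_power2 power_strict_mono sum_gp_strict)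
    also have "\<dots> = 1 + (\<Sum>j<k. ennreal (2 ^ j))"
      by (subst ennreal_plus) (auto intro!: sum_nonneg simp: sum_ennreal)
    also have "(\<Sum>j<k. ennreal (2 ^ j)) = (\<Sum>j<k. ennreal (2 ^ j) * indicator {v. ennreal (2 ^ j) < v} u)"
    proof (rule sum.cong)
      fix j assume "j \<in> {..<k}"
      then have "ennreal (2 ^ j) < y"
        using z k(2) by (simp add: ennreal_less_iff)
      then show "ennreal (2 ^ j) = ennreal (2 ^ j) * indicator {v. ennreal (2 ^ j) < v} u"
        using \<open>y < u\<close> by simp
    qed simp
    also have "1 + \<dots> \<le> 1 + (\<Sum>k. ennreal (2 ^ k) * indicator {v. ennreal (2 ^ k) < v} u)"
      by (intro add_left_mono sum_le_suminf) auto
    finally show ?thesis .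
  qed
qed

text \<open>Weak \<open>L^p\<close> with \<open>p > 1\<close> is integrable on sets of finite
  measure: dyadic level \<open>k\<close> contributes a multiple of
  \<open>2 ^ k * (2 ^ k) powr (- p) = q ^ k\<close> with \<open>q < 1\<close>, and values up to 1
  contribute at most the volume of the ball. Here \<open>p > 1\<close> comes from
  \<open>0 < \<alpha>\<close>.\<close>

lemma frac_maximal_integrable_ball:
  fixes h :: "'a::euclidean_space \<Rightarrow> real"
  assumes [measurable]: "h \<in> borel_measurable lebesgue"
    and fin: "(\<integral>\<^sup>+ y. ennreal \<bar>h y\<bar> \<partial>lebesgue) < \<infinity>"
    and \<alpha>: "0 < \<alpha>" "\<alpha> < real DIM('a)"
  shows "(\<integral>\<^sup>+ x\<in>ball c r. frac_maximal \<alpha> h x \<partial>lebesgue) < \<infinity>"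
proof -
  \<comment> \<open>The added 1 keeps \<open>H\<close> positive even when \<open>h\<close> vanishes
    almost everywhere.\<close>
  define H where "H = enn2real (\<integral>\<^sup>+ y. ennreal \<bar>h y\<bar> \<partial>lebesgue) + 1"
  have H: "0 < H" "(\<integral>\<^sup>+ y. ennreal \<bar>h y\<bar> \<partial>lebesgue) \<le> ennreal H"
    using fin by (auto simp: H_def add_nonneg_pos ennreal_plus)
  define p where "p = real DIM('a) / (real DIM('a) - \<alpha>)"
  have p: "1 < p"
    using \<alpha> by (simp add: p_def field_simps)
  define q :: real where "q = 2 powr (1 - p)"
  have q: "0 < q" "q < 1"
    using p by (auto simp: q_def powr_less_one)
  define E where "E k = {x. ennreal (2 ^ k) < frac_maximal \<alpha> h x}" for k :: nat
  have [measurable]: "E k \<in> sets lebesgue" for k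
    using measurable_sets[OF frac_maximal_measurable_lebesgue[of \<alpha> h], of "{ennreal (2 ^ k)<..}"]
    by (simp add: E_def vimage_def)
  define b where "b = 5 ^ DIM('a) * H powr p"
  have level: "ennreal (2 ^ k) * emeasure lebesgue (E k) \<le> ennreal (b * q ^ k)" for k
  proof -
    have "ennreal (2 ^ k) * emeasure lebesgue (E k)
        \<le> ennreal (2 ^ k) * ennreal (5 ^ DIM('a) * H powr p * (2 ^ k) powr (- p))"
      unfolding E_def p_def using H \<alpha> by (intro mult_left_mono frac_maximal_weak_Lp) auto
    also have "\<dots> = ennreal (b * (2 ^ k * (2 ^ k) powr (- p)))"
      using H by (simp add: b_def ennreal_mult[symmetric] mult_ac)
    also have "2 ^ k * (2 ^ k) powr (- p) = q ^ k"
      by (simp add: q_def powr_realpow[symmetric] powr_powr powr_add[symmetric] algebra_simps)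
    finally show ?thesis .
  qed
  have "(\<integral>\<^sup>+ x\<in>ball c r. frac_maximal \<alpha> h x \<partial>lebesgue)
      \<le> (\<integral>\<^sup>+ x. indicator (ball c r) x + (\<Sum>k. ennreal (2 ^ k) * indicator (E k) x) \<partial>lebesgue)"
  proof (intro nn_integral_mono)
    fix x
    show "frac_maximal \<alpha> h x * indicator (ball c r) x
        \<le> indicator (ball c r) x + (\<Sum>k. ennreal (2 ^ k) * indicator (E k) x)"
      using ennreal_le_dyadic_sum[of "frac_maximal \<alpha> h x"]
      by (auto simp: E_def indicator_def)
  qed
  also have "\<dots> = emeasure lebesgue (ball c r) + (\<Sum>k. ennreal (2 ^ k) * emeasure lebesgue (E k))"
    by (subst nn_integral_add) (auto simp: nn_integral_suminf nn_integral_cmult_indicator)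
  also have "\<dots> \<le> emeasure lebesgue (ball c r) + (\<Sum>k. ennreal (b * q ^ k))"
    by (intro add_left_mono suminf_le level) auto
  also have "\<dots> < \<infinity>"
  proof -
    have "summable (\<lambda>k. b * q ^ k)"
      using q by (intro summable_mult summable_geometric) auto
    then have "(\<Sum>k. ennreal (b * q ^ k)) \<noteq> top"
      using q H by (intro ennreal_suminf_neq_top) (auto simp: b_def)
    then show ?thesis
      unfolding emeasure_lebesgue_ball by (simp add: less_top)
  qed
  finally show ?thesis .
qed

lemma frac_maximal_L1_loc:
  fixes f :: "'a::euclidean_space \<Rightarrow> real"
  assumes f: "f \<in> L1_loc" and \<alpha>: "0 < \<alpha>" "\<alpha> < real DIM('a)"
    and x0: "frac_maximal \<alpha> f x0 < \<infinity>"
  shows "(\<lambda>x. enn2real (frac_maximal \<alpha> f x)) \<in> L1_loc"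
  unfolding L1_loc_def
proof (intro CollectI allI impI)
  fix K :: "'a set" assume K: "compact K"
  have [measurable]: "f \<in> borel_measurable lebesgue"
    using f by (rule L1_loc_measurable)
  have [measurable]: "K \<in> sets lebesgue"
    using K by (simp add: compact_imp_closed)
  obtain R' where R': "\<And>x. x \<in> K \<Longrightarrow> norm x \<le> R'"
    using K compact_imp_bounded bounded_iff by metis
  \<comment> \<open>Large enough for \<open>ball 0 R\<close> to contain both \<open>K\<close> and
    the base point \<open>x0\<close>.\<close>
  define R where "R = \<bar>R'\<bar> + norm x0 + 1"
  have R: "0 < R" "norm x0 < R" "K \<subseteq> ball 0 R"
    using R' by (auto simp: R_def add_nonneg_pos intro: le_less_trans[of _ "\<bar>R'\<bar>"])
       (smt (verit) norm_ge_zero)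
  define h where "h x = indicator (ball 0 (3 * R)) x *\<^sub>R f x" for x
  have [measurable]: "h \<in> borel_measurable lebesgue"
    unfolding h_def by measurable
  have h_fin: "(\<integral>\<^sup>+ y. ennreal \<bar>h y\<bar> \<partial>lebesgue) < \<infinity>"
  proof -
    have "set_integrable lebesgue (cball 0 (3 * R)) f"
      using f by (simp add: L1_loc_def)
    then have "(\<integral>\<^sup>+ y. ennreal (norm (indicator (cball 0 (3 * R)) y *\<^sub>R f y)) \<partial>lebesgue) < \<infinity>"
      unfolding set_integrable_def by (simp add: integrable_iff_bounded)
    moreover have "(\<integral>\<^sup>+ y. ennreal \<bar>h y\<bar> \<partial>lebesgue)
        \<le> (\<integral>\<^sup>+ y. ennreal (norm (indicator (cball 0 (3 * R)) y *\<^sub>R f y)) \<partial>lebesgue)"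
      by (intro nn_integral_mono) (auto simp: h_def split: split_indicator)
    ultimately show ?thesis by simp
  qed
  define e where "e = - 1 + \<alpha> / real DIM('a)"
  \<comment> \<open>The loss from replacing the volume of a ball by that of its threefold
    enlargement in the weight with exponent \<open>e\<close>.\<close>
  define k :: real where "k = (3 ^ DIM('a)) powr (- e)"
  \<comment> \<open>If \<open>R \<le> r\<close>, then \<open>r + 2 * R \<le> 3 * r\<close> and the
    enlarged ball contains \<open>x0\<close>. If \<open>r < R\<close>, then
    \<open>2 * r + R < 3 * R\<close> and the ball lies where \<open>h\<close> agrees with
    \<open>f\<close>.\<close>
  have split: "frac_maximal \<alpha> f x \<le> ennreal k * frac_maximal \<alpha> f x0 + frac_maximal \<alpha> h x"
    if x: "x \<in> ball 0 R" for x
  proof (rule frac_maximal_le)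
    fix c r assume r: "0 < r" "x \<in> ball c r"
    have xx0: "dist c x0 < r + 2 * R"
    proof -
      have "dist c x0 \<le> dist c x + dist x x0" by (rule dist_triangle)
      also have "dist x x0 \<le> norm x + norm x0" by (simp add: dist_norm norm_triangle_ineq4)
      finally show ?thesis using r x R by simp
    qed
    show "ennreal (measure lebesgue (ball c r) powr (- 1 + \<alpha> / real DIM('a))) *
        (\<integral>\<^sup>+ y\<in>ball c r. ennreal \<bar>f y\<bar> \<partial>lebesgue)
      \<le> ennreal k * frac_maximal \<alpha> f x0 + frac_maximal \<alpha> h x"
    proof (cases "R \<le> r")
      case True
      have "x0 \<in> ball c (3 * r)"
        using xx0 True by simp
      have "measure lebesgue (ball c r) powr e = k * measure lebesgue (ball c (3 * r)) powr e"
      proof -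
        have "measure lebesgue (ball c (3 * r)) = 3 ^ DIM('a) * measure lebesgue (ball c r)"
          using r by (intro measure_lebesgue_ball_scale) auto
        then have "k * measure lebesgue (ball c (3 * r)) powr e
            = k * (3 ^ DIM('a)) powr e * measure lebesgue (ball c r) powr e"
          by (simp add: powr_mult)
        also have "k * (3 ^ DIM('a)) powr e = 1"
          by (simp add: k_def powr_add[symmetric])
        finally show ?thesis by simp
      qed
      then have "ennreal (measure lebesgue (ball c r) powr e) * (\<integral>\<^sup>+ y\<in>ball c r. ennreal \<bar>f y\<bar> \<partial>lebesgue)
          = ennreal k * (ennreal (measure lebesgue (ball c (3 * r)) powr e) * (\<integral>\<^sup>+ y\<in>ball c r. ennreal \<bar>f y\<bar> \<partial>lebesgue))"
        by (simp add: ennreal_mult mult.assoc k_def)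
      also have "\<dots> \<le> ennreal k * (ennreal (measure lebesgue (ball c (3 * r)) powr e) * (\<integral>\<^sup>+ y\<in>ball c (3 * r). ennreal \<bar>f y\<bar> \<partial>lebesgue))"
        using r by (intro mult_left_mono nn_integral_mono) (auto split: split_indicator)
      also have "\<dots> \<le> ennreal k * frac_maximal \<alpha> f x0"
        unfolding e_def using r \<open>x0 \<in> ball c (3 * r)\<close>
        by (intro mult_left_mono frac_maximal_ge) auto
      finally show ?thesis
        unfolding e_def by (rule order_trans) simp
    next
      case False
      have "ball c r \<subseteq> ball 0 (3 * R)"
      proof
        fix y assume y: "y \<in> ball c r"
        have "norm y \<le> dist y c + dist c x + norm x"
          using dist_triangle[of y 0 c] dist_triangle[of c 0 x] by simp
        then show "y \<in> ball 0 (3 * R)"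
          using y r x False by (simp add: dist_commute)
      qed
      then have "(\<integral>\<^sup>+ y\<in>ball c r. ennreal \<bar>f y\<bar> \<partial>lebesgue) = (\<integral>\<^sup>+ y\<in>ball c r. ennreal \<bar>h y\<bar> \<partial>lebesgue)"
        by (intro nn_integral_cong) (auto simp: h_def split: split_indicator)
      then have "ennreal (measure lebesgue (ball c r) powr (- 1 + \<alpha> / real DIM('a))) *
          (\<integral>\<^sup>+ y\<in>ball c r. ennreal \<bar>f y\<bar> \<partial>lebesgue) \<le> frac_maximal \<alpha> h x"
        using frac_maximal_ge[OF r] by simp
      then show ?thesis
        by (rule order_trans) simp
    qed
  qed
  show "set_integrable lebesgue K (\<lambda>x. enn2real (frac_maximal \<alpha> f x))"
    unfolding set_integrable_def
  proof (rule integrableI_bounded)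
    show "(\<lambda>x. indicator K x *\<^sub>R enn2real (frac_maximal \<alpha> f x)) \<in> borel_measurable lebesgue"
      by measurable
    have "(\<integral>\<^sup>+ x. ennreal (norm (indicator K x *\<^sub>R enn2real (frac_maximal \<alpha> f x))) \<partial>lebesgue)
        \<le> (\<integral>\<^sup>+ x. ennreal k * frac_maximal \<alpha> f x0 * indicator (ball 0 R) x +
              frac_maximal \<alpha> h x * indicator (ball 0 R) x \<partial>lebesgue)"
    proof (intro nn_integral_mono)
      fix x
      have "ennreal (enn2real (frac_maximal \<alpha> f x)) \<le> frac_maximal \<alpha> f x"
        by (cases "frac_maximal \<alpha> f x") auto
      then show "ennreal (norm (indicator K x *\<^sub>R enn2real (frac_maximal \<alpha> f x)))
          \<le> ennreal k * frac_maximal \<alpha> f x0 * indicator (ball 0 R) x +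
              frac_maximal \<alpha> h x * indicator (ball 0 R) x"
        using split[of x] R(3) by (auto split: split_indicator intro: order_trans)
    qed
    also have "\<dots> = ennreal k * frac_maximal \<alpha> f x0 * emeasure lebesgue (ball 0 R :: 'a set) +
        (\<integral>\<^sup>+ x\<in>ball 0 R. frac_maximal \<alpha> h x \<partial>lebesgue)"
      by (subst nn_integral_add) (auto simp: nn_integral_cmult_indicator)
    also have "\<dots> < \<infinity>"
      using x0 frac_maximal_integrable_ball[OF _ h_fin \<alpha>, of 0 R]
      unfolding emeasure_lebesgue_ball by (simp add: ennreal_mult_less_top)
    finally show "(\<integral>\<^sup>+ x. ennreal (norm (indicator K x *\<^sub>R enn2real (frac_maximal \<alpha> f x))) \<partial>lebesgue) < \<infinity>" .
  qed
qed

subsection \<open>Weak boundedness and necessity\<close>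

text \<open>Both kinds of norm are infima over admissible scalings, so a norm inequality with
  constant \<open>K\<close> reduces to this: if \<mu> is admissible for \<open>f\<close>, then
  \<open>K * \<mu>\<close> is admissible for the image.\<close>

lemma Inf_ennreal_scale:
  assumes K: "0 < K" and "\<And>\<mu>. 0 < \<mu> \<Longrightarrow> P \<mu> \<Longrightarrow> Q (K * \<mu>)"
  shows "Inf {ennreal \<mu> | \<mu>. \<mu> > 0 \<and> Q \<mu>} \<le> ennreal K * Inf {ennreal \<mu> | \<mu>. \<mu> > 0 \<and> P \<mu>}"
    (is "?X \<le> _ * ?Y")
proof -
  have "ennreal (1 / K) * ?X \<le> ?Y"
  proof (rule Inf_greatest)
    fix y assume "y \<in> {ennreal \<mu> | \<mu>. \<mu> > 0 \<and> P \<mu>}"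
    then obtain \<mu> where \<mu>: "y = ennreal \<mu>" "\<mu> > 0" "P \<mu>" by auto
    then have "?X \<le> ennreal (K * \<mu>)"
      using assms by (intro Inf_lower) auto
    then have "ennreal (1 / K) * ?X \<le> ennreal (1 / K) * ennreal (K * \<mu>)"
      by (rule mult_left_mono) simp
    also have "\<dots> = y"
      using K \<mu> by (simp add: ennreal_mult[symmetric])
    finally show "ennreal (1 / K) * ?X \<le> y" .
  qed
  then have "ennreal K * (ennreal (1 / K) * ?X) \<le> ennreal K * ?Y"
    by (rule mult_left_mono) simp
  moreover have "ennreal K * (ennreal (1 / K) * ?X) = ?X"
    using K by (simp add: mult.assoc[symmetric] ennreal_mult[symmetric])
  ultimately show ?thesis by simp
qed

text \<open>Shrinking the function by \<open>k \<le> 1\<close> shrinks the modular at least as much;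
  constants in modular estimates are absorbed in this way.\<close>

lemma young_modular_scale:
  fixes f :: "'a::euclidean_space \<Rightarrow> real"
  assumes Y: "\<Phi> \<in> young_class_Y" and [measurable]: "f \<in> borel_measurable lebesgue"
    and k: "0 \<le> k" "k \<le> 1"
  shows "(\<integral>\<^sup>+ x. \<Phi> (k * \<bar>f x\<bar>) \<partial>lebesgue) \<le> ennreal k * (\<integral>\<^sup>+ x. \<Phi> \<bar>f x\<bar> \<partial>lebesgue)"
proof -
  have [measurable]: "(\<lambda>y. \<Phi> \<bar>f y\<bar>) \<in> borel_measurable lebesgue"
    by (rule young_comp_measurable[OF Y]) auto
  have "(\<integral>\<^sup>+ x. \<Phi> (k * \<bar>f x\<bar>) \<partial>lebesgue) \<le> (\<integral>\<^sup>+ x. ennreal k * \<Phi> \<bar>f x\<bar> \<partial>lebesgue)"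
    using k by (intro nn_integral_mono young_scale young_class_Y_D[OF Y]) auto
  then show ?thesis
    by (simp add: nn_integral_cmult)
qed

lemma orlicz_space_admissible:
  fixes f :: "'a::euclidean_space \<Rightarrow> real"
  assumes Y: "\<Phi> \<in> young_class_Y" and f: "f \<in> orlicz_space \<Phi>"
  obtains \<mu> where "0 < \<mu>" "(\<integral>\<^sup>+ x. \<Phi> (\<bar>f x\<bar> / \<mu>) \<partial>lebesgue) \<le> 1"
proof -
  obtain k where k: "0 < k" "(\<integral>\<^sup>+ x. \<Phi> (k * \<bar>f x\<bar>) \<partial>lebesgue) < \<infinity>" and "f \<in> L1_loc"
    using f by (auto simp: orlicz_space_def)
  then have [measurable]: "f \<in> borel_measurable lebesgue"
    by (intro L1_loc_measurable)
  obtain i where i: "(\<integral>\<^sup>+ x. \<Phi> (k * \<bar>f x\<bar>) \<partial>lebesgue) = ennreal i" "0 \<le> i"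
    using k(2) by (cases "\<integral>\<^sup>+ x. \<Phi> (k * \<bar>f x\<bar>) \<partial>lebesgue") auto
  show thesis
  proof
    \<comment> \<open>Dividing by the further factor \<open>1 + i\<close> brings the modular
      \<open>i\<close> down to at most \<open>i / (1 + i) \<le> 1\<close>.\<close>
    show "0 < (1 + i) / k" using k i by simp
    have "(\<integral>\<^sup>+ x. \<Phi> (\<bar>f x\<bar> / ((1 + i) / k)) \<partial>lebesgue)
        = (\<integral>\<^sup>+ x. \<Phi> (1 / (1 + i) * \<bar>k * f x\<bar>) \<partial>lebesgue)"
      using k by (intro nn_integral_cong arg_cong[where f = \<Phi>]) (simp add: abs_mult field_simps)
    also have "\<dots> \<le> ennreal (1 / (1 + i)) * (\<integral>\<^sup>+ x. \<Phi> \<bar>k * f x\<bar> \<partial>lebesgue)"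
      using i by (intro young_modular_scale[OF Y]) auto
    also have "\<dots> = ennreal (1 / (1 + i)) * ennreal i"
      using i k by (simp add: abs_mult)
    also have "\<dots> = ennreal (1 / (1 + i) * i)"
      using i(2) by (intro ennreal_mult[symmetric]) auto
    also have "\<dots> \<le> 1"
      using i by (simp add: field_simps)
    finally show "(\<integral>\<^sup>+ x. \<Phi> (\<bar>f x\<bar> / ((1 + i) / k)) \<partial>lebesgue) \<le> 1" .
  qed
qed

lemma orlicz_norm_finite:
  assumes "\<Phi> \<in> young_class_Y" "f \<in> orlicz_space \<Phi>"
  shows "orlicz_norm \<Phi> f < \<infinity>"
proof -
  obtain \<mu> where "0 < \<mu>" "(\<integral>\<^sup>+ x. \<Phi> (\<bar>f x\<bar> / \<mu>) \<partial>lebesgue) \<le> 1"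
    using orlicz_space_admissible[OF assms] .
  then have "orlicz_norm \<Phi> f \<le> ennreal \<mu>"
    unfolding orlicz_norm_def by (intro Inf_lower) auto
  then show ?thesis
    by (rule le_less_trans) simp
qed

text \<open>The factor \<open>5 ^ DIM('a)\<close> is moved from the right-hand side into the level:
  dividing \<open>f\<close> by \<mu> and by this factor leaves a modular of at most its reciprocal,
  which cancels it.\<close>

lemma frac_maximal_weak_admissible:
  fixes f :: "'a::euclidean_space \<Rightarrow> real"
  assumes Y: "\<Phi> \<in> young_class_Y" and \<alpha>: "0 \<le> \<alpha>"
    and C: "0 < C" "\<And>r. 0 < r \<Longrightarrow>
      r powr (- \<alpha> / real DIM('a)) * young_inverse \<Phi> r \<le> C * young_inverse \<Psi> r"
    and f[measurable]: "f \<in> borel_measurable lebesgue"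
    and \<mu>: "0 < \<mu>" "(\<integral>\<^sup>+ x. \<Phi> (\<bar>f x\<bar> / \<mu>) \<partial>lebesgue) \<le> 1"
    and t: "0 < t"
  shows "\<Psi> t * emeasure lebesgue {x. ennreal (4 * C * 5 ^ DIM('a) * \<mu> * t) < frac_maximal \<alpha> f x} \<le> 1"
proof -
  define D :: real where "D = 5 ^ DIM('a)"
  have D: "1 \<le> D" by (simp add: D_def)
  define h where "h x = 1 / (D * \<mu>) * f x" for x
  have [measurable]: "h \<in> borel_measurable lebesgue"
    unfolding h_def by measurable
  have "(\<integral>\<^sup>+ x. \<Phi> \<bar>h x\<bar> \<partial>lebesgue) = (\<integral>\<^sup>+ x. \<Phi> (1 / D * \<bar>f x / \<mu>\<bar>) \<partial>lebesgue)"
    using D \<mu> by (intro nn_integral_cong arg_cong[where f = \<Phi>]) (simp add: h_def abs_mult)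
  also have "\<dots> \<le> ennreal (1 / D) * (\<integral>\<^sup>+ x. \<Phi> \<bar>f x / \<mu>\<bar> \<partial>lebesgue)"
    using D by (intro young_modular_scale[OF Y]) auto
  also have "\<dots> \<le> ennreal (1 / D) * 1"
    using \<mu> by (intro mult_left_mono) auto
  finally have h: "(\<integral>\<^sup>+ x. \<Phi> \<bar>h x\<bar> \<partial>lebesgue) \<le> ennreal (1 / D)"
    by simp
  also have "\<dots> \<le> 1"
    using D by simp
  finally have h1: "(\<integral>\<^sup>+ x. \<Phi> \<bar>h x\<bar> \<partial>lebesgue) \<le> 1" .
  have "{x. ennreal (4 * C * D * \<mu> * t) < frac_maximal \<alpha> f x} \<subseteq> {x. ennreal (4 * C * t) < frac_maximal \<alpha> h x}"
  proof clarify
    fix x assume "ennreal (4 * C * D * \<mu> * t) < frac_maximal \<alpha> f x"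
    then have "ennreal (1 / (D * \<mu>)) * ennreal (4 * C * D * \<mu> * t) < ennreal (1 / (D * \<mu>)) * frac_maximal \<alpha> f x"
      using D \<mu> by (intro ennreal_mult_strict_left_mono) auto
    also have "ennreal (1 / (D * \<mu>)) * ennreal (4 * C * D * \<mu> * t) = ennreal (1 / (D * \<mu>) * (4 * C * D * \<mu> * t))"
      using D \<mu> C t by (intro ennreal_mult[symmetric]) auto
    also have "1 / (D * \<mu>) * (4 * C * D * \<mu> * t) = 4 * C * t"
      using D \<mu> by (simp add: field_simps)
    also have "ennreal (1 / (D * \<mu>)) * frac_maximal \<alpha> f x = frac_maximal \<alpha> h x"
      unfolding h_def using D \<mu> by (intro frac_maximal_cmult[symmetric]) auto
    finally show "ennreal (4 * C * t) < frac_maximal \<alpha> h x" .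
  qed
  then have "\<Psi> t * emeasure lebesgue {x. ennreal (4 * C * D * \<mu> * t) < frac_maximal \<alpha> f x}
      \<le> \<Psi> t * emeasure lebesgue {x. ennreal (4 * C * t) < frac_maximal \<alpha> h x}"
    by (intro mult_left_mono emeasure_mono) auto
  also have "\<dots> \<le> 5 ^ DIM('a) * (\<integral>\<^sup>+ x. \<Phi> \<bar>h x\<bar> \<partial>lebesgue)"
    using h1 t by (intro frac_maximal_weak_type[OF Y \<alpha> C]) auto
  also have "\<dots> \<le> ennreal D * ennreal (1 / D)"
    using h by (intro mult_mono) (auto simp: D_def ennreal_power[symmetric])
  also have "\<dots> = 1"
    using D by (simp add: ennreal_mult[symmetric])
  finally show ?thesis
    by (simp add: D_def)
qed

text \<open>The set of infinite values lies in every superlevel set, so its measure times \<Psi>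
  \<open>t\<close> is at most 1 for all \<open>t > 0\<close>; as \<Psi> is unbounded, the measure is
  0.\<close>

lemma frac_maximal_AE_finite:
  fixes f :: "'a::euclidean_space \<Rightarrow> real"
  assumes Y: "\<Phi> \<in> young_class_Y" and \<Psi>: "young_function \<Psi>" and \<alpha>: "0 \<le> \<alpha>"
    and C: "0 < C" "\<And>r. 0 < r \<Longrightarrow>
      r powr (- \<alpha> / real DIM('a)) * young_inverse \<Phi> r \<le> C * young_inverse \<Psi> r"
    and f[measurable]: "f \<in> borel_measurable lebesgue"
    and \<mu>: "0 < \<mu>" "(\<integral>\<^sup>+ x. \<Phi> (\<bar>f x\<bar> / \<mu>) \<partial>lebesgue) \<le> 1"
  shows "AE x in lebesgue. frac_maximal \<alpha> f x < \<infinity>"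
proof -
  define N where "N = {x. frac_maximal \<alpha> f x = \<infinity>}"
  have N[measurable]: "N \<in> sets lebesgue"
    using measurable_sets[OF frac_maximal_measurable_lebesgue[of \<alpha> f], of "{\<infinity>}"]
    by (simp add: N_def vimage_def)
  have le: "\<Psi> t * emeasure lebesgue N \<le> 1" if "0 < t" for t
  proof -
    have "\<Psi> t * emeasure lebesgue N
        \<le> \<Psi> t * emeasure lebesgue {x. ennreal (4 * C * 5 ^ DIM('a) * \<mu> * t) < frac_maximal \<alpha> f x}"
      by (intro mult_left_mono emeasure_mono) (auto simp: N_def)
    also have "\<dots> \<le> 1"
      using that by (intro frac_maximal_weak_admissible[OF Y \<alpha> C f \<mu>])
    finally show ?thesis .
  qed
  have "emeasure lebesgue N = 0"
  proof (rule ccontr)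
    assume "emeasure lebesgue N \<noteq> 0"
    then obtain e where e: "0 < e" "ennreal e \<le> emeasure lebesgue N"
      using ennreal_pos_lower_real by (metis zero_less_iff_neq_zero)
    \<comment> \<open>With this \<open>t\<close> the product with the measure of \<open>N\<close> is
      at least 2, against the bound 1.\<close>
    obtain t where t: "0 \<le> t" "ennreal (2 / e) < \<Psi> t"
      using young_inverse_nonempty[OF \<Psi>] by blast
    then have "0 < t"
      using \<Psi> by (cases "t = 0") (auto simp: young_function_def)
    have "(2::ennreal) = ennreal (2 / e) * ennreal e"
      using e by (simp add: ennreal_mult[symmetric])
    also have "\<dots> \<le> \<Psi> t * emeasure lebesgue N"
      using t e by (intro mult_mono) auto
    also have "\<dots> \<le> 1"
      using \<open>0 < t\<close> by (rule le)
    finally show False by simp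
  qed
  then have "N \<in> null_sets lebesgue"
    using N by blast
  then show ?thesis
    by (rule AE_I') (auto simp: N_def less_top[symmetric])
qed

text \<open>Supplies the base point \<open>x0\<close> for local integrability out of
  almost-everywhere finiteness.\<close>

lemma AE_lebesgue_ex:
  assumes "AE x in lebesgue. P (x :: 'a::euclidean_space)"
  obtains x where "P x"
proof (rule ccontr)
  assume "\<not> thesis"
  then have "AE x in (lebesgue :: 'a measure). False"
    using assms that by auto
  then have "emeasure (lebesgue :: 'a measure) UNIV = 0"
    using AE_iff_null_sets[of UNIV "lebesgue :: 'a measure"] by auto
  then show False by simp
qed

lemma weak_orlicz_bounded:
  assumes Y: "\<Phi> \<in> young_class_Y" and \<Psi>: "young_function \<Psi>"
    and \<alpha>: "0 < \<alpha>" "\<alpha> < real DIM('a::euclidean_space)"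
    and C: "0 < C" "\<And>r. 0 < r \<Longrightarrow>
      r powr (- \<alpha> / real DIM('a)) * young_inverse \<Phi> r \<le> C * young_inverse \<Psi> r"
  shows "bounded_operator (orlicz_space \<Phi> :: ('a \<Rightarrow> real) set) (orlicz_norm \<Phi>)
           (weak_orlicz_space \<Psi>) (weak_orlicz_norm \<Psi>) (frac_maximal \<alpha>)"
  unfolding bounded_operator_def
proof (intro exI[of _ "4 * C * 5 ^ DIM('a)"] conjI ballI)
  show "0 < 4 * C * 5 ^ DIM('a)" using C by simp
  fix f :: "'a \<Rightarrow> real" assume f: "f \<in> orlicz_space \<Phi>"
  then have fL: "f \<in> L1_loc" by (simp add: orlicz_space_def)
  then have [measurable]: "f \<in> borel_measurable lebesgue" by (rule L1_loc_measurable)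
  obtain \<mu> where \<mu>: "0 < \<mu>" "(\<integral>\<^sup>+ x. \<Phi> (\<bar>f x\<bar> / \<mu>) \<partial>lebesgue) \<le> 1"
    using orlicz_space_admissible[OF Y f] .
  show fin: "AE x in lebesgue. frac_maximal \<alpha> f x < \<infinity>"
    using \<alpha> \<mu> C by (intro frac_maximal_AE_finite[OF Y \<Psi> _ C(1)]) auto
  let ?g = "\<lambda>x. enn2real (frac_maximal \<alpha> f x)"
  let ?K = "4 * C * 5 ^ DIM('a)"
  show norm: "weak_orlicz_norm \<Psi> ?g \<le> ennreal ?K * orlicz_norm \<Phi> f"
    unfolding weak_orlicz_norm_def orlicz_norm_def
  proof (rule Inf_ennreal_scale)
    fix \<mu> :: real assume \<mu>: "0 < \<mu>" "(\<integral>\<^sup>+ x. \<Phi> (\<bar>f x\<bar> / \<mu>) \<partial>lebesgue) \<le> 1"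
    show "(SUP t\<in>{0<..}. \<Psi> t * emeasure lebesgue {x. \<bar>?g x\<bar> / (?K * \<mu>) > t}) \<le> 1"
    proof (rule SUP_least)
      fix t :: real assume "t \<in> {0<..}"
      then have t: "0 < t" by simp
      \<comment> \<open>Only an inclusion holds in general: \<open>enn2real\<close> sends
        \<infinity> to 0 and so never enlarges a superlevel set.\<close>
      have "{x. t < \<bar>?g x\<bar> / (?K * \<mu>)} \<subseteq> {x. ennreal (?K * \<mu> * t) < frac_maximal \<alpha> f x}"
      proof clarify
        fix x assume "t < \<bar>?g x\<bar> / (?K * \<mu>)"
        then have "?K * \<mu> * t < ?g x"
          using C \<mu> by (simp add: field_simps)
        then have "ennreal (?K * \<mu> * t) < ennreal (?g x)"
          using C \<mu> t by (intro ennreal_lessI) (auto intro: le_less_trans[rotated])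
        also have "\<dots> \<le> frac_maximal \<alpha> f x"
          by (cases "frac_maximal \<alpha> f x") auto
        finally show "ennreal (?K * \<mu> * t) < frac_maximal \<alpha> f x" .
      qed
      then have "\<Psi> t * emeasure lebesgue {x. t < \<bar>?g x\<bar> / (?K * \<mu>)}
          \<le> \<Psi> t * emeasure lebesgue {x. ennreal (?K * \<mu> * t) < frac_maximal \<alpha> f x}"
        by (intro mult_left_mono emeasure_mono) auto
      also have "\<dots> \<le> 1"
        using \<alpha> t C by (intro frac_maximal_weak_admissible[OF Y _ C(1) _ _ \<mu>]) auto
      finally show "\<Psi> t * emeasure lebesgue {x. t < \<bar>?g x\<bar> / (?K * \<mu>)} \<le> 1" .
    qed
  qed (use C in simp)
  obtain x0 where "frac_maximal \<alpha> f x0 < \<infinity>"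
    using AE_lebesgue_ex[OF fin] .
  then have "?g \<in> L1_loc"
    by (intro frac_maximal_L1_loc[OF fL \<alpha>])
  moreover have "weak_orlicz_norm \<Psi> ?g < \<infinity>"
    using norm orlicz_norm_finite[OF Y f] by (auto simp: ennreal_mult_less_top intro: le_less_trans)
  ultimately show "?g \<in> weak_orlicz_space \<Psi>"
    by (simp add: weak_orlicz_space_def)
qed

text \<open>Chebyshev's inequality for \<Psi>: every \<mu> admissible for the strong norm is
  admissible for the weak one.\<close>

lemma weak_orlicz_norm_le_orlicz_norm:
  fixes g :: "'a::euclidean_space \<Rightarrow> real"
  assumes \<Psi>: "young_function \<Psi>" and [measurable]: "g \<in> borel_measurable lebesgue"
  shows "weak_orlicz_norm \<Psi> g \<le> orlicz_norm \<Psi> g"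
  unfolding weak_orlicz_norm_def orlicz_norm_def
proof (rule Inf_superset_mono, clarify)
  fix \<mu> :: real assume \<mu>: "0 < \<mu>" "(\<integral>\<^sup>+ x. \<Psi> (\<bar>g x\<bar> / \<mu>) \<partial>lebesgue) \<le> 1"
  have "\<Psi> t * emeasure lebesgue {x. t < \<bar>g x\<bar> / \<mu>} \<le> 1" if t: "0 < t" for t
  proof -
    have "{x \<in> space lebesgue. t < \<bar>g x\<bar> / \<mu>} \<in> sets lebesgue"
      by measurable
    then have [measurable]: "{x. t < \<bar>g x\<bar> / \<mu>} \<in> sets lebesgue"
      by simp
    have "\<Psi> t * emeasure lebesgue {x. t < \<bar>g x\<bar> / \<mu>}
        = (\<integral>\<^sup>+ x. \<Psi> t * indicator {x. t < \<bar>g x\<bar> / \<mu>} x \<partial>lebesgue)"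
      by (simp add: nn_integral_cmult_indicator)
    also have "\<dots> \<le> (\<integral>\<^sup>+ x. \<Psi> (\<bar>g x\<bar> / \<mu>) \<partial>lebesgue)"
      using t by (intro nn_integral_mono) (auto split: split_indicator intro!: young_mono[OF \<Psi>])
    also note \<mu>(2)
    finally show ?thesis .
  qed
  then show "\<exists>\<mu>'. ennreal \<mu> = ennreal \<mu>' \<and> \<mu>' > 0 \<and>
      (SUP t\<in>{0<..}. \<Psi> t * emeasure lebesgue {x. \<bar>g x\<bar> / \<mu>' > t}) \<le> 1"
    using \<mu> by (intro exI[of _ \<mu>]) (auto intro!: SUP_least)
qed

text \<open>Reduces necessity for the strong type to necessity for the weak type.\<close>

lemma bounded_operator_orlicz_imp_weak:
  assumes Y: "\<Phi> \<in> young_class_Y" and \<Psi>: "young_function \<Psi>"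
    and "bounded_operator (orlicz_space \<Phi> :: ('a::euclidean_space \<Rightarrow> real) set) (orlicz_norm \<Phi>)
           (orlicz_space \<Psi>) (orlicz_norm \<Psi>) T"
  shows "bounded_operator (orlicz_space \<Phi> :: ('a \<Rightarrow> real) set) (orlicz_norm \<Phi>)
           (weak_orlicz_space \<Psi>) (weak_orlicz_norm \<Psi>) T"
proof -
  obtain C where C: "C > 0" and bd: "\<And>f. f \<in> orlicz_space \<Phi> \<Longrightarrow>
      (AE x in lebesgue. T f x < \<infinity>) \<and> (\<lambda>x. enn2real (T f x)) \<in> orlicz_space \<Psi> \<and>
      orlicz_norm \<Psi> (\<lambda>x. enn2real (T f x)) \<le> ennreal C * orlicz_norm \<Phi> f"
    using assms(3) unfolding bounded_operator_def by blast
  show ?thesis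
    unfolding bounded_operator_def
  proof (intro exI[of _ C] conjI ballI C)
    fix f :: "'a \<Rightarrow> real" assume f: "f \<in> orlicz_space \<Phi>"
    show "AE x in lebesgue. T f x < \<infinity>"
      using bd[OF f] by blast
    have L: "(\<lambda>x. enn2real (T f x)) \<in> L1_loc"
      using bd[OF f] by (simp add: orlicz_space_def)
    then have "weak_orlicz_norm \<Psi> (\<lambda>x. enn2real (T f x)) \<le> orlicz_norm \<Psi> (\<lambda>x. enn2real (T f x))"
      by (intro weak_orlicz_norm_le_orlicz_norm \<Psi> L1_loc_measurable)
    also have "\<dots> \<le> ennreal C * orlicz_norm \<Phi> f"
      using bd[OF f] by blast
    finally show le: "weak_orlicz_norm \<Psi> (\<lambda>x. enn2real (T f x)) \<le> ennreal C * orlicz_norm \<Phi> f" .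
    show "(\<lambda>x. enn2real (T f x)) \<in> weak_orlicz_space \<Psi>"
      using L le orlicz_norm_finite[OF Y f]
      by (auto simp: weak_orlicz_space_def ennreal_mult_less_top intro: le_less_trans)
  qed
qed

section \<open>Necessity of the condition\<close>

text \<open>The indicator of a ball of volume \<open>1 / r\<close> has norm at most
  \<open>2 / young_inverse \<Phi> r\<close>, while its image is at least
  \<open>r powr (- \<alpha> / n)\<close> on that ball; the weak norm of the image then bounds this
  value by a multiple of \<open>young_inverse \<Psi> r\<close>.\<close>

lemma weak_orlicz_bounded_imp_inverse_le:
  assumes Y: "\<Phi> \<in> young_class_Y" and \<Psi>: "young_function \<Psi>"
    and bd: "bounded_operator (orlicz_space \<Phi> :: ('a::euclidean_space \<Rightarrow> real) set) (orlicz_norm \<Phi>)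
           (weak_orlicz_space \<Psi>) (weak_orlicz_norm \<Psi>) (frac_maximal \<alpha>)"
  shows "\<exists>C>0. \<forall>r>0. r powr (- \<alpha> / real DIM('a)) * young_inverse \<Phi> r \<le> C * young_inverse \<Psi> r"
proof -
  note Y' = young_class_Y_D[OF Y]
  obtain C where C: "C > 0" and bd: "\<And>f :: 'a \<Rightarrow> real. f \<in> orlicz_space \<Phi> \<Longrightarrow>
      (AE x in lebesgue. frac_maximal \<alpha> f x < \<infinity>) \<and>
      weak_orlicz_norm \<Psi> (\<lambda>x. enn2real (frac_maximal \<alpha> f x)) \<le> ennreal C * orlicz_norm \<Phi> f"
    using bd unfolding bounded_operator_def by blast
  have "r powr (- \<alpha> / real DIM('a)) * young_inverse \<Phi> r \<le> 4 * C * young_inverse \<Psi> r"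
    if r: "0 < r" for r
  proof -
    obtain \<rho> where \<rho>: "0 < \<rho>" "measure lebesgue (ball (0 :: 'a) \<rho>) = 1 / r"
      using exists_ball_measure[of "1 / r" "0 :: 'a"] r by auto
    define B where "B = ball (0 :: 'a) \<rho>"
    have V: "emeasure lebesgue B = ennreal (1 / r)"
      unfolding B_def emeasure_lebesgue_ball \<rho>(2) ..
    have [measurable]: "B \<in> sets lebesgue" by (simp add: B_def)
    define f :: "'a \<Rightarrow> real" where "f = indicator B"
    define i where "i = young_inverse \<Phi> r"
    have i: "0 < i" unfolding i_def using Y'(1) r by (rule young_inverse_pos)
    \<comment> \<open>Halving \<open>i\<close> provides the strict inequality needed below the
      inverse.\<close>
    have "\<Phi> (i / 2) \<le> ennreal r"
      using i by (intro young_le_of_less_inverse) (auto simp: i_def)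
    have "(\<integral>\<^sup>+ x. \<Phi> (\<bar>f x\<bar> / (2 / i)) \<partial>lebesgue) = (\<integral>\<^sup>+ x. \<Phi> (i / 2) * indicator B x \<partial>lebesgue)"
      using Y'(1) by (intro nn_integral_cong) (auto simp: f_def young_function_def split: split_indicator)
    also have "\<dots> = \<Phi> (i / 2) * ennreal (1 / r)"
      by (simp add: nn_integral_cmult_indicator V)
    also have "\<dots> \<le> ennreal r * ennreal (1 / r)"
      by (intro mult_right_mono \<open>\<Phi> (i / 2) \<le> ennreal r\<close>) auto
    also have "\<dots> = 1"
      using r by (simp add: ennreal_mult[symmetric])
    finally have mod: "(\<integral>\<^sup>+ x. \<Phi> (\<bar>f x\<bar> / (2 / i)) \<partial>lebesgue) \<le> 1" .
    then have norm_f: "orlicz_norm \<Phi> f \<le> ennreal (2 / i)"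
      unfolding orlicz_norm_def using i by (intro Inf_lower) auto
    have "f \<in> L1_loc"
      unfolding L1_loc_def
    proof (intro CollectI allI impI)
      fix K :: "'a set" assume "compact K"
      then have "K \<inter> B \<in> lmeasurable"
        unfolding B_def by (intro fmeasurable_Int_fmeasurable lmeasurable_compact) auto
      then have "integrable lebesgue (indicator (K \<inter> B) :: 'a \<Rightarrow> real)"
        by (intro integrable_real_indicator) (auto simp: fmeasurable_def)
      then show "set_integrable lebesgue K f"
        unfolding set_integrable_def f_def
        by (simp add: indicator_inter_arith[abs_def])
    qed
    moreover have "(\<integral>\<^sup>+ x. \<Phi> (i / 2 * \<bar>f x\<bar>) \<partial>lebesgue) < \<infinity>"
      using mod by (auto simp: mult.commute intro: le_less_trans)
    ultimately have f: "f \<in> orlicz_space \<Phi>"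
      using i unfolding orlicz_space_def by (intro CollectI conjI exI[of _ "i / 2"]) auto
    define g where "g x = enn2real (frac_maximal \<alpha> f x)" for x
    have [measurable]: "g \<in> borel_measurable lebesgue"
      unfolding g_def by measurable
    have "weak_orlicz_norm \<Psi> g \<le> ennreal C * orlicz_norm \<Phi> f"
      using bd[OF f] by (simp add: g_def[abs_def])
    also have "\<dots> \<le> ennreal C * ennreal (2 / i)"
      by (intro mult_left_mono norm_f) auto
    also have "\<dots> = ennreal (C * (2 / i))"
      using C i by (intro ennreal_mult[symmetric]) auto
    \<comment> \<open>The constant is doubled to make the inequality strict, so that an admissible
      \<open>l\<close> below it can be picked; the infimum need not be attained.\<close>
    also have "\<dots> < ennreal (4 * C / i)"
      using C i by (intro ennreal_lessI) (auto simp: field_simps)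
    finally obtain l where l: "0 < l" "ennreal l < ennreal (4 * C / i)"
      and sup: "(SUP t\<in>{0<..}. \<Psi> t * emeasure lebesgue {x. \<bar>g x\<bar> / l > t}) \<le> 1"
      unfolding weak_orlicz_norm_def Inf_less_iff by auto
    have l_less: "l < 4 * C / i"
      using l by (simp add: ennreal_less_iff)
    define w where "w = r powr (- \<alpha> / real DIM('a))"
    have w: "0 < w" using r by (simp add: w_def)
    \<comment> \<open>Only almost everywhere: at a point of infinite value \<open>g\<close> is
      0.\<close>
    have AE_g: "AE x in lebesgue. x \<in> B \<longrightarrow> w \<le> g x"
      using bd[OF f, THEN conjunct1]
    proof eventually_elim
      case (elim x)
      show ?case
      proof
        assume "x \<in> B"
        then have "ennreal (measure lebesgue B powr (- 1 + \<alpha> / real DIM('a))) *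
            (\<integral>\<^sup>+ y\<in>B. ennreal \<bar>f y\<bar> \<partial>lebesgue) \<le> frac_maximal \<alpha> f x"
          unfolding B_def using \<rho> by (intro frac_maximal_ge) auto
        also have "(\<integral>\<^sup>+ y\<in>B. ennreal \<bar>f y\<bar> \<partial>lebesgue) = (\<integral>\<^sup>+ y. indicator B y \<partial>lebesgue)"
          by (intro nn_integral_cong) (auto simp: f_def split: split_indicator)
        also have "\<dots> = ennreal (1 / r)"
          by (simp add: V)
        also have "ennreal (measure lebesgue B powr (- 1 + \<alpha> / real DIM('a))) * ennreal (1 / r)
            = ennreal ((1 / r) powr (\<alpha> / real DIM('a) - 1) * (1 / r))"
          using r by (simp add: B_def \<rho>(2) ennreal_mult[symmetric])
        also have "(1 / r) powr (\<alpha> / real DIM('a) - 1) * (1 / r) = w"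
          using r powr_average[of "1 / r" "\<alpha> / real DIM('a)"]
          by (simp add: w_def powr_divide powr_minus_divide)
        also have "frac_maximal \<alpha> f x = ennreal (g x)"
          using elim by (simp add: g_def)
        finally show "w \<le> g x"
          by (simp add: ennreal_le_iff2 g_def) (use w in linarith)
      qed
    qed
    \<comment> \<open>If some \<open>s < w / l\<close> had \<open>\<Psi> s > r\<close>, almost all
      of \<open>B\<close> would lie where \<open>\<bar>g x\<bar> / l > s\<close>, and the weak bound
      would give \<open>\<Psi> s * (1 / r) \<le> 1\<close>.\<close>
    have "w / l \<le> young_inverse \<Psi> r"
    proof (rule young_inverse_greatest[OF \<Psi>], rule ccontr)
      fix s assume s: "0 \<le> s" "ennreal r < \<Psi> s" "\<not> w / l \<le> s"
      then have s0: "0 < s"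
        using \<Psi> by (cases "s = 0") (auto simp: young_function_def)
      have "emeasure lebesgue B \<le> emeasure lebesgue {x. \<bar>g x\<bar> / l > s}"
      proof (rule emeasure_mono_AE)
        show "AE x in lebesgue. x \<in> B \<longrightarrow> x \<in> {x. \<bar>g x\<bar> / l > s}"
          using AE_g
        proof eventually_elim
          case (elim x)
          have "s < w / l" using s by simp
          then have "s * l < w" using l by (simp add: field_simps)
          then show ?case
            using elim l(1) by (auto simp: field_simps)
        qed
        have "{x \<in> space lebesgue. \<bar>g x\<bar> / l > s} \<in> sets lebesgue" by measurable
        then show "{x. \<bar>g x\<bar> / l > s} \<in> sets lebesgue" by simp
      qed
      then have "\<Psi> s * ennreal (1 / r) \<le> \<Psi> s * emeasure lebesgue {x. \<bar>g x\<bar> / l > s}"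
        unfolding V by (rule mult_left_mono) simp
      also have "\<dots> \<le> 1"
        using sup s0 by (simp add: SUP_le_iff)
      finally have "\<Psi> s * ennreal (1 / r) \<le> 1" .
      moreover have "ennreal r * ennreal (1 / r) < \<Psi> s * ennreal (1 / r)"
        using s r by (intro ennreal_mult_strict_right_mono) auto
      ultimately show False
        using r by (simp add: ennreal_mult[symmetric])
    qed
    then have "w \<le> l * young_inverse \<Psi> r"
      using l by (simp add: field_simps)
    also have "\<dots> \<le> 4 * C / i * young_inverse \<Psi> r"
      using l_less young_inverse_pos[OF \<Psi> r] by (intro mult_right_mono) auto
    finally show ?thesis
      using i by (simp add: w_def i_def[symmetric] field_simps)
  qed
  then show ?thesis
    using C by (intro exI[of _ "4 * C"]) auto
qed

subsection \<open>Strong boundedness\<close>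

text \<open>Values of \<open>\<bar>f\<bar>\<close> up to \<open>t / 2\<close> contribute at most
  \<open>t / 2\<close> to any mean, so in a ball of mean above \<open>t\<close> the larger values
  carry at least half of it. Doubling \<open>f\<close> puts the truncation at
  \<open>t\<close>.\<close>

lemma maximal_truncated_weak_type:
  fixes f :: "'a::euclidean_space \<Rightarrow> real"
  assumes [measurable]: "f \<in> borel_measurable lebesgue" and t: "0 < t"
  shows "ennreal t * emeasure lebesgue {x. ennreal t < frac_maximal 0 f x}
    \<le> 5 ^ DIM('a) * (\<integral>\<^sup>+ y. ennreal (2 * \<bar>f y\<bar>) * indicator {s. t < s} (2 * \<bar>f y\<bar>) \<partial>lebesgue)"
proof (rule Vitali_weak_type)
  let ?g = "\<lambda>y. ennreal (2 * \<bar>f y\<bar>) * indicator {s. t < s} (2 * \<bar>f y\<bar>)"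
  have [measurable]: "{s. t < s} \<in> sets borel"
    by (simp add: greaterThan_def[symmetric])
  show [measurable]: "?g \<in> borel_measurable lebesgue"
    by measurable
  fix x assume "x \<in> {x. ennreal t < frac_maximal 0 f x}"
  then obtain c r where r: "0 < r" "x \<in> ball c r" and
    gt: "ennreal t < ennreal (measure lebesgue (ball c r) powr (- 1 + 0 / real DIM('a))) *
      (\<integral>\<^sup>+ y\<in>ball c r. ennreal \<bar>f y\<bar> \<partial>lebesgue)"
    by (auto elim: less_frac_maximalE)
  define V where "V = measure lebesgue (ball c r)"
  have V: "0 < V" unfolding V_def using r(1) by (rule measure_lebesgue_ball_pos)
  define I where "I = (\<integral>\<^sup>+ y\<in>ball c r. ennreal \<bar>f y\<bar> \<partial>lebesgue)"
  have "ennreal V * ennreal t \<le> ennreal V * (ennreal (1 / V) * I)"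
    using gt V unfolding V_def[symmetric] I_def[symmetric]
    by (intro mult_left_mono) (auto simp: powr_minus_divide)
  also have "\<dots> = I"
    using V by (simp add: mult.assoc[symmetric] ennreal_mult[symmetric])
  finally have tI: "ennreal (t * V) \<le> I"
    using t V by (simp add: ennreal_mult mult.commute)
  \<comment> \<open>Doubled so that one copy of \<open>t * V\<close> can be cancelled against the
    contribution of the small values; cancellation is safe as this copy is finite.\<close>
  have "ennreal (t * V) + ennreal (t * V) \<le> I + I"
    by (intro add_mono tI)
  also have "\<dots> = 2 * I"
    by (simp add: mult_2)
  also have "\<dots> = (\<integral>\<^sup>+ y. 2 * (ennreal \<bar>f y\<bar> * indicator (ball c r) y) \<partial>lebesgue)"
    unfolding I_def by (intro nn_integral_cmult[symmetric]) measurable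
  also have "\<dots> \<le> (\<integral>\<^sup>+ y. ennreal t * indicator (ball c r) y + ?g y * indicator (ball c r) y \<partial>lebesgue)"
  proof (intro nn_integral_mono)
    fix y
    have "2 * ennreal \<bar>f y\<bar> = ennreal (2 * \<bar>f y\<bar>)"
      by (simp add: ennreal_mult)
    moreover have "ennreal (2 * \<bar>f y\<bar>) \<le> ennreal t" if "\<not> t < 2 * \<bar>f y\<bar>"
      using that by (intro ennreal_leI) simp
    ultimately show "2 * (ennreal \<bar>f y\<bar> * indicator (ball c r) y)
        \<le> ennreal t * indicator (ball c r) y + ?g y * indicator (ball c r) y"
      by (auto split: split_indicator)
  qed
  also have "\<dots> = ennreal t * emeasure lebesgue (ball c r) + (\<integral>\<^sup>+ y\<in>ball c r. ?g y \<partial>lebesgue)"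
    by (subst nn_integral_add) (auto simp: nn_integral_cmult_indicator)
  also have "ennreal t * emeasure lebesgue (ball c r) = ennreal (t * V)"
    unfolding emeasure_lebesgue_ball V_def using t by (simp add: ennreal_mult)
  finally have "ennreal (t * V) \<le> (\<integral>\<^sup>+ y\<in>ball c r. ?g y \<partial>lebesgue)"
    by (simp add: ennreal_add_left_cancel_le)
  then have "ennreal t * emeasure lebesgue (ball c r) \<le> (\<integral>\<^sup>+ y\<in>ball c r. ?g y \<partial>lebesgue)"
    unfolding emeasure_lebesgue_ball V_def using t by (simp add: ennreal_mult)
  with r show "\<exists>c r. 0 < r \<and> x \<in> ball c r \<and>
      ennreal t * emeasure lebesgue (ball c r) \<le> (\<integral>\<^sup>+ y\<in>ball c r. ?g y \<partial>lebesgue)"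
    by blast
qed

lemma powr_int_bracket:
  fixes a s :: real
  assumes "1 < a" "0 < s"
  obtains k :: int where "a powr k < s" "s \<le> a powr (real_of_int k + 1)"
    "\<And>j. a powr (real_of_int j) < s \<longleftrightarrow> j \<le> k"
proof -
  \<comment> \<open>Not the floor of the logarithm: when \<open>s\<close> is an exact power of
    \<open>a\<close>, the strict inequality \<open>a powr k < s\<close> requires the preceding
    exponent.\<close>
  define k where "k = \<lceil>log a s\<rceil> - 1"
  have less: "a powr j < s \<longleftrightarrow> real_of_int j < log a s" for j :: int
    using assms by (simp add: less_log_iff)
  have iff: "a powr j < s \<longleftrightarrow> j \<le> k" for j :: int
    unfolding less k_def by linarith
  have "a powr k < s" by (simp add: iff)
  moreover have "s \<le> a powr (real_of_int k + 1)"
    using iff[of "k + 1"] by (simp add: not_less)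
  ultimately show thesis
    using that[of k] iff by blast
qed

text \<open>
  The \<open>\<nabla>\<^sub>2\<close> condition makes the terms grow at least by a factor of two with \<open>k\<close>, so that the
  sum is comparable to its last term.
\<close>

lemma nabla2_level_sum:
  assumes Y: "\<Phi> \<in> young_class_Y" and a: "1 < a"
    and nab: "\<And>r. 0 \<le> r \<Longrightarrow> \<Phi> r \<le> ennreal (1 / (2 * a)) * \<Phi> (a * r)"
    and s: "0 \<le> s"
  shows "(\<integral>\<^sup>+ k. \<Phi> (a powr (real_of_int k + 1)) * ennreal (a powr (- real_of_int k)) *
      (ennreal s * indicator {s. a powr (real_of_int k) < s} s) \<partial>count_space (UNIV :: int set))
    \<le> ennreal (2 * a) * \<Phi> (a * s)"
proof (cases "s = 0")
  case True
  then show ?thesis by simp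
next
  case False
  with s have s: "0 < s" by simp
  note Y' = young_class_Y_D[OF Y]
  define b where "b k = \<Phi> (a powr (real_of_int k + 1)) * ennreal (a powr (- real_of_int k))" for k
  obtain K :: int where K: "a powr K < s" "s \<le> a powr (real_of_int K + 1)" "\<And>j. a powr (real_of_int j) < s \<longleftrightarrow> j \<le> K"
    using powr_int_bracket[OF a s] by metis
  \<comment> \<open>Passing from \<open>k\<close> to \<open>k - 1\<close> gains
    \<open>1 / (2 * a)\<close> in \<Phi> by the hypothesis \<open>nab\<close> and loses
    \<open>a\<close> in the weight, for a net factor of one half.\<close>
  have step: "b (k - 1) \<le> ennreal (1 / 2) * b k" for k
  proof -
    have "b (k - 1) = \<Phi> (a powr k) * ennreal (a * a powr (- real_of_int k))"
      using a by (simp add: b_def powr_add powr_diff powr_minus field_simps)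
    also have "\<dots> \<le> (ennreal (1 / (2 * a)) * \<Phi> (a * a powr k)) * ennreal (a * a powr (- real_of_int k))"
      by (intro mult_right_mono nab) auto
    also have "a * a powr k = a powr (real_of_int k + 1)"
      using a by (simp add: powr_add)
    also have "(ennreal (1 / (2 * a)) * \<Phi> (a powr (real_of_int k + 1))) * ennreal (a * a powr (- real_of_int k))
        = \<Phi> (a powr (real_of_int k + 1)) * (ennreal (1 / (2 * a)) * ennreal (a * a powr (- real_of_int k)))"
      by (simp only: mult_ac)
    also have "ennreal (1 / (2 * a)) * ennreal (a * a powr (- real_of_int k))
        = ennreal (1 / (2 * a) * (a * a powr (- real_of_int k)))"
      using a by (intro ennreal_mult[symmetric]) auto
    also have "1 / (2 * a) * (a * a powr (- real_of_int k)) = 1 / 2 * a powr (- real_of_int k)"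
      using a by (simp add: field_simps)
    also have "ennreal \<dots> = ennreal (1 / 2) * ennreal (a powr (- real_of_int k))"
      by (intro ennreal_mult) auto
    finally show ?thesis
      by (simp add: b_def mult_ac)
  qed
  have geo: "b (K - int j) \<le> ennreal ((1 / 2) ^ j) * b K" for j
  proof (induction j)
    case (Suc j)
    have "b (K - int (Suc j)) = b (K - int j - 1)"
      by (simp add: algebra_simps)
    also have "\<dots> \<le> ennreal (1 / 2) * b (K - int j)"
      by (rule step)
    also have "\<dots> \<le> ennreal (1 / 2) * (ennreal ((1 / 2) ^ j) * b K)"
      by (intro mult_left_mono Suc) auto
    also have "\<dots> = ennreal (1 / 2 * (1 / 2) ^ j) * b K"
      by (subst ennreal_mult) (simp_all add: mult.assoc)
    also have "\<dots> = ennreal ((1 / 2) ^ Suc j) * b K"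
      by simp
    finally show ?case .
  qed simp
  \<comment> \<open>The two sides of the bracket are used separately: \<open>a powr K < s\<close>
    bounds the argument of \<Phi>, and \<open>s \<le> a powr (K + 1)\<close> bounds the weight times
    \<open>s\<close> by \<open>a\<close>.\<close>
  have bK: "b K * ennreal s \<le> ennreal a * \<Phi> (a * s)"
  proof -
    have "\<Phi> (a powr (real_of_int K + 1)) \<le> \<Phi> (a * s)"
      using a K(1) by (intro young_mono Y') (auto simp: powr_add)
    then have "b K * ennreal s \<le> \<Phi> (a * s) * ennreal (a powr (- real_of_int K)) * ennreal s"
      unfolding b_def by (intro mult_right_mono) auto
    also have "\<dots> = \<Phi> (a * s) * ennreal (a powr (- real_of_int K) * s)"
      using s by (simp add: ennreal_mult mult.assoc)
    also have "\<dots> \<le> \<Phi> (a * s) * ennreal a"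
    proof (intro mult_left_mono ennreal_leI)
      have "s \<le> a * a powr K"
        using K(2) a by (simp add: powr_add mult.commute)
      then show "a powr (- real_of_int K) * s \<le> a"
        using a by (simp add: powr_minus field_simps)
    qed auto
    finally show ?thesis by (simp add: mult.commute)
  qed
  \<comment> \<open>The indicator keeps exactly the indices up to \<open>K\<close>; counting
    downwards from \<open>K\<close> turns the sum into a geometric series over the naturals.\<close>
  have bij: "bij_betw (\<lambda>j. K - int j) UNIV {..K}"
    by (rule bij_betwI[where g = "\<lambda>k. nat (K - k)"]) auto
  have "(\<integral>\<^sup>+ k. b k * (ennreal s * indicator {s. a powr (real_of_int k) < s} s) \<partial>count_space UNIV)
      = (\<integral>\<^sup>+ k. (b k * ennreal s) * indicator {..K} k \<partial>count_space UNIV)"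
    by (intro nn_integral_cong) (auto simp: K(3) split: split_indicator)
  also have "\<dots> = (\<integral>\<^sup>+ k. b k * ennreal s \<partial>count_space {..K})"
    by (simp add: nn_integral_count_space_indicator)
  also have "\<dots> = (\<integral>\<^sup>+ j. b (K - int j) * ennreal s \<partial>count_space UNIV)"
    by (rule nn_integral_bij_count_space[OF bij, symmetric])
  also have "\<dots> = (\<Sum>j. b (K - int j) * ennreal s)"
    by (rule nn_integral_count_space_nat)
  also have "\<dots> \<le> (\<Sum>j. ennreal ((1 / 2) ^ j) * (b K * ennreal s))"
    unfolding mult.assoc[symmetric] by (intro suminf_le mult_right_mono geo) auto
  also have "\<dots> = (\<Sum>j. ennreal ((1 / 2) ^ j)) * (b K * ennreal s)"
    by (rule ennreal_suminf_multc)
  also have "(\<Sum>j. ennreal ((1 / 2) ^ j)) = ennreal 2"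
  proof (rule sums_unique[symmetric])
    have "(\<lambda>j. (1 / 2 :: real) ^ j) sums 2"
      using geometric_sums[of "1 / 2 :: real"] by simp
    then show "(\<lambda>j. ennreal ((1 / 2) ^ j)) sums ennreal 2"
      by (subst sums_ennreal) auto
  qed
  also have "ennreal 2 * (b K * ennreal s) \<le> ennreal 2 * (ennreal a * \<Phi> (a * s))"
    by (intro mult_left_mono bK) auto
  also have "\<dots> = ennreal (2 * a) * \<Phi> (a * s)"
    using a by (subst ennreal_mult) (auto simp: mult.assoc)
  finally show ?thesis
    by (simp add: b_def)
qed

text \<open>On each level set \<open>E k\<close> the truncated weak-type bound is applied at height
  \<open>a powr k\<close>. After exchanging sum and integral, the levels seen by a fixed
  \<open>y\<close> are those below \<open>2 * \<bar>f y\<bar>\<close>, and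
  \<open>nabla2_level_sum\<close> adds them up.\<close>

lemma maximal_modular:
  fixes f :: "'a::euclidean_space \<Rightarrow> real"
  assumes Y: "\<Phi> \<in> young_class_Y" and a: "1 < a"
    and nab: "\<And>r. 0 \<le> r \<Longrightarrow> \<Phi> r \<le> ennreal (1 / (2 * a)) * \<Phi> (a * r)"
    and f[measurable]: "f \<in> borel_measurable lebesgue"
  shows "(\<integral>\<^sup>+ x. \<Phi> (enn2real (frac_maximal 0 f x)) \<partial>lebesgue)
    \<le> ennreal (2 * a * 5 ^ DIM('a)) * (\<integral>\<^sup>+ x. \<Phi> (2 * a * \<bar>f x\<bar>) \<partial>lebesgue)"
proof -
  note Y' = young_class_Y_D[OF Y]
  define E where "E k = {x. ennreal (a powr k) < frac_maximal 0 f x}" for k :: int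
  have [measurable]: "E k \<in> sets lebesgue" for k
    using measurable_sets[OF frac_maximal_measurable_lebesgue[of 0 f], of "{ennreal (a powr k)<..}"]
    by (simp add: E_def vimage_def)
  define P where "P k = \<Phi> (a powr (real_of_int k + 1))" for k :: int
  define g where "g k y = ennreal (2 * \<bar>f y\<bar>) * indicator {s. a powr (real_of_int k) < s} (2 * \<bar>f y\<bar>)"
    for k :: int and y
  have [measurable]: "{s. a powr (real_of_int k) < s} \<in> sets borel" for k :: int
    by (simp add: greaterThan_def[symmetric])
  have [measurable]: "g k \<in> borel_measurable lebesgue" for k
    unfolding g_def by measurable
  have [measurable]: "(\<lambda>x. \<Phi> (2 * a * \<bar>f x\<bar>)) \<in> borel_measurable lebesgue"
    using a by (intro young_comp_measurable[OF Y]) auto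
  \<comment> \<open>A single level suffices, namely the one bracketing the value. Infinite values
    become 0, where \<Phi> vanishes.\<close>
  have pt: "\<Phi> (enn2real (frac_maximal 0 f x)) \<le> (\<integral>\<^sup>+ k. P k * indicator (E k) x \<partial>count_space UNIV)" for x
  proof (cases "enn2real (frac_maximal 0 f x) = 0")
    case True
    then show ?thesis using Y'(1) by (simp add: young_function_def)
  next
    case False
    define m where "m = enn2real (frac_maximal 0 f x)"
    have m: "0 < m" using False by (simp add: m_def less_le)
    have m': "frac_maximal 0 f x = ennreal m"
      using False unfolding m_def by (cases "frac_maximal 0 f x") auto
    obtain k :: int where k: "a powr k < m" "m \<le> a powr (real_of_int k + 1)"
      using powr_int_bracket[OF a m] by metis
    have "\<Phi> m \<le> P k"
      unfolding P_def using m k by (intro young_mono Y') auto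
    also have "\<dots> = P k * indicator (E k) x"
      using k m by (simp add: E_def m' ennreal_less_iff)
    also have "\<dots> \<le> (\<integral>\<^sup>+ k. P k * indicator (E k) x \<partial>count_space UNIV)"
      by (rule nn_integral_ge_point) simp
    finally show ?thesis by (simp add: m_def)
  qed
  have level: "P k * emeasure lebesgue (E k)
      \<le> (\<integral>\<^sup>+ y. 5 ^ DIM('a) * (P k * ennreal (a powr (- real_of_int k)) * g k y) \<partial>lebesgue)" for k
  proof -
    have "ennreal (a powr k) * emeasure lebesgue (E k) \<le> 5 ^ DIM('a) * (\<integral>\<^sup>+ y. g k y \<partial>lebesgue)"
      unfolding E_def g_def using a by (intro maximal_truncated_weak_type) auto
    then have "ennreal (a powr (- real_of_int k)) * (ennreal (a powr k) * emeasure lebesgue (E k))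
        \<le> ennreal (a powr (- real_of_int k)) * (5 ^ DIM('a) * (\<integral>\<^sup>+ y. g k y \<partial>lebesgue))"
      by (rule mult_left_mono) simp
    also have "ennreal (a powr (- real_of_int k)) * (ennreal (a powr k) * emeasure lebesgue (E k))
        = emeasure lebesgue (E k)"
      using a by (simp add: mult.assoc[symmetric] ennreal_mult[symmetric] powr_add[symmetric])
    finally have "P k * emeasure lebesgue (E k)
        \<le> P k * (ennreal (a powr (- real_of_int k)) * (5 ^ DIM('a) * (\<integral>\<^sup>+ y. g k y \<partial>lebesgue)))"
      by (rule mult_left_mono) simp
    also have "\<dots> = 5 ^ DIM('a) * (P k * ennreal (a powr (- real_of_int k))) * (\<integral>\<^sup>+ y. g k y \<partial>lebesgue)"
      by (simp only: mult_ac)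
    also have "\<dots> = (\<integral>\<^sup>+ y. 5 ^ DIM('a) * (P k * ennreal (a powr (- real_of_int k))) * g k y \<partial>lebesgue)"
      by (rule nn_integral_cmult[symmetric]) measurable
    finally show ?thesis by (simp only: mult.assoc)
  qed
  have "(\<integral>\<^sup>+ x. \<Phi> (enn2real (frac_maximal 0 f x)) \<partial>lebesgue)
      \<le> (\<integral>\<^sup>+ x. \<integral>\<^sup>+ k. P k * indicator (E k) x \<partial>count_space UNIV \<partial>lebesgue)"
    by (intro nn_integral_mono pt)
  also have "\<dots> = (\<integral>\<^sup>+ k. \<integral>\<^sup>+ x. P k * indicator (E k) x \<partial>lebesgue \<partial>count_space UNIV)"
    by (intro nn_integral_count_space_nn_integral) auto
  also have "\<dots> = (\<integral>\<^sup>+ k. P k * emeasure lebesgue (E k) \<partial>count_space UNIV)"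
    by (simp add: nn_integral_cmult_indicator)
  also have "\<dots> \<le> (\<integral>\<^sup>+ k. \<integral>\<^sup>+ y. 5 ^ DIM('a) * (P k * ennreal (a powr (- real_of_int k)) * g k y) \<partial>lebesgue \<partial>count_space UNIV)"
    by (intro nn_integral_mono level)
  also have "\<dots> = (\<integral>\<^sup>+ y. \<integral>\<^sup>+ k. 5 ^ DIM('a) * (P k * ennreal (a powr (- real_of_int k)) * g k y) \<partial>count_space UNIV \<partial>lebesgue)"
    by (intro nn_integral_count_space_nn_integral[symmetric]) auto
  also have "\<dots> \<le> (\<integral>\<^sup>+ y. 5 ^ DIM('a) * (ennreal (2 * a) * \<Phi> (2 * a * \<bar>f y\<bar>)) \<partial>lebesgue)"
  proof (intro nn_integral_mono)
    fix y
    have "(\<integral>\<^sup>+ k. 5 ^ DIM('a) * (P k * ennreal (a powr (- real_of_int k)) * g k y) \<partial>count_space UNIV)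
        = 5 ^ DIM('a) * (\<integral>\<^sup>+ k. P k * ennreal (a powr (- real_of_int k)) * g k y \<partial>count_space UNIV)"
      by (rule nn_integral_cmult) simp
    also have "\<dots> \<le> 5 ^ DIM('a) * (ennreal (2 * a) * \<Phi> (a * (2 * \<bar>f y\<bar>)))"
      unfolding P_def g_def by (intro mult_left_mono nabla2_level_sum[OF Y a nab]) auto
    finally show "(\<integral>\<^sup>+ k. 5 ^ DIM('a) * (P k * ennreal (a powr (- real_of_int k)) * g k y) \<partial>count_space UNIV)
        \<le> 5 ^ DIM('a) * (ennreal (2 * a) * \<Phi> (2 * a * \<bar>f y\<bar>))"
      by (simp add: mult_ac)
  qed
  also have "\<dots> = 5 ^ DIM('a) * ennreal (2 * a) * (\<integral>\<^sup>+ y. \<Phi> (2 * a * \<bar>f y\<bar>) \<partial>lebesgue)"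
    by (subst nn_integral_cmult, measurable)+ (simp only: mult.assoc)
  also have "5 ^ DIM('a) * ennreal (2 * a) = ennreal (2 * a * 5 ^ DIM('a))"
    using a by (subst (2) ennreal_mult) (auto simp: mult.commute ennreal_power[symmetric])
  finally show ?thesis .
qed

section \<open>Pointwise comparison with the Hardy-Littlewood operator and the strong bound\<close>

text \<open>A Hedberg-type argument: with \<open>q\<close> the value of \<Phi> at the
  Hardy-Littlewood maximal function, balls are split at volume \<open>1 / q\<close>. On either side
  the weighted mean is at most a multiple of \<open>young_inverse \<Psi> q\<close>.\<close>

lemma frac_maximal_pointwise:
  fixes f :: "'a::euclidean_space \<Rightarrow> real"
  assumes Y: "\<Phi> \<in> young_class_Y" and \<Psi>: "young_function \<Psi>" and \<alpha>: "0 \<le> \<alpha>"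
    and C: "0 < C" "\<And>r. 0 < r \<Longrightarrow>
      r powr (- \<alpha> / real DIM('a)) * young_inverse \<Phi> r \<le> C * young_inverse \<Psi> r"
    and f[measurable]: "f \<in> borel_measurable lebesgue"
    and f1: "(\<integral>\<^sup>+ y. \<Phi> \<bar>f y\<bar> \<partial>lebesgue) \<le> 1"
    and fin: "frac_maximal 0 f x < \<infinity>"
  shows "\<Psi> (enn2real (frac_maximal \<alpha> f x) / (8 * C)) \<le> \<Phi> (enn2real (frac_maximal 0 f x))"
proof -
  note Y' = young_class_Y_D[OF Y]
  define m where "m = enn2real (frac_maximal 0 f x)"
  have m': "frac_maximal 0 f x = ennreal m" "0 \<le> m"
    using fin by (auto simp: m_def)
  let ?n = "real DIM('a)"
  have avg: "(\<integral>\<^sup>+ y\<in>ball c r. ennreal \<bar>f y\<bar> \<partial>lebesgue) \<le> ennreal (m * measure lebesgue (ball c r))"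
    if r: "0 < r" "x \<in> ball c r" for c r
  proof -
    define V where "V = measure lebesgue (ball c r)"
    have V: "0 < V" unfolding V_def using r(1) by (rule measure_lebesgue_ball_pos)
    have "ennreal (V powr (- 1 + 0 / ?n)) * (\<integral>\<^sup>+ y\<in>ball c r. ennreal \<bar>f y\<bar> \<partial>lebesgue) \<le> ennreal m"
      unfolding m'(1)[symmetric] V_def using r by (rule frac_maximal_ge)
    then have "(\<integral>\<^sup>+ y\<in>ball c r. ennreal \<bar>f y\<bar> \<partial>lebesgue) \<le> ennreal (m / V powr (- 1 + 0 / ?n))"
      using V m' by (intro ennreal_le_divideI) auto
    also have "m / V powr (- 1 + 0 / ?n) = m * V"
      using V by (simp add: powr_minus field_simps)
    finally show ?thesis by (simp add: V_def)
  qed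
  show ?thesis
  proof (cases "m = 0")
    case True
    have "frac_maximal \<alpha> f x \<le> 0"
    proof (rule frac_maximal_le)
      fix c r assume "0 < r" "x \<in> ball c r"
      then have "(\<integral>\<^sup>+ y\<in>ball c r. ennreal \<bar>f y\<bar> \<partial>lebesgue) = 0"
        using avg[of r c] True by simp
      then show "ennreal (measure lebesgue (ball c r) powr (- 1 + \<alpha> / ?n)) *
          (\<integral>\<^sup>+ y\<in>ball c r. ennreal \<bar>f y\<bar> \<partial>lebesgue) \<le> 0" by simp
    qed
    then show ?thesis
      using \<Psi> by (simp add: young_function_def)
  next
    case False
    with m' have m: "0 < m" by simp
    define q where "q = enn2real (\<Phi> m)"
    have q': "\<Phi> m = ennreal q"
      using Y'(3)[of m] m by (simp add: q_def)
    have q: "0 < q"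
      using Y'(2)[OF m] by (simp add: q')
    define p where "p = young_inverse \<Psi> q"
    have p: "0 < p" unfolding p_def using \<Psi> q by (rule young_inverse_pos)
    have "frac_maximal \<alpha> f x \<le> ennreal (4 * C * p)"
    proof (rule frac_maximal_le)
      fix c r assume r: "0 < r" "x \<in> ball c r"
      define V where "V = measure lebesgue (ball c r)"
      have V: "0 < V" unfolding V_def using r(1) by (rule measure_lebesgue_ball_pos)
      have "ennreal (V powr (- 1 + \<alpha> / ?n)) * (\<integral>\<^sup>+ y\<in>ball c r. ennreal \<bar>f y\<bar> \<partial>lebesgue) \<le> ennreal (4 * C * p)"
      proof -
        obtain u where u: "0 \<le> u" "(\<integral>\<^sup>+ y\<in>ball c r. ennreal \<bar>f y\<bar> \<partial>lebesgue) \<le> ennreal (u * V)"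
          "V powr (\<alpha> / ?n) * u \<le> 4 * C * p"
        \<comment> \<open>\<open>u\<close> bounds the mean of \<open>\<bar>f\<bar>\<close>. For
          small balls it is \<open>m\<close>, and the condition is used at \<open>q\<close>; for
          large balls it comes from the normalised modular, and the condition is used at
          \<open>1 / V < q\<close> before \<open>young_inverse \<Psi>\<close> is increased to its
          value at \<open>q\<close>.\<close>
        proof (cases "q \<le> 1 / V")
          case True
          have Vq: "V \<le> 1 / q"
            using True V q by (simp add: field_simps)
          have "V powr (\<alpha> / ?n) * m \<le> (1 / q) powr (\<alpha> / ?n) * young_inverse \<Phi> q"
          proof (rule mult_mono)
            show "m \<le> young_inverse \<Phi> q"
              by (intro le_young_inverse Y') (simp add: q')
            show "V powr (\<alpha> / ?n) \<le> (1 / q) powr (\<alpha> / ?n)"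
              using V Vq \<alpha> by (intro powr_mono2) auto
          qed (use m in auto)
          also have "\<dots> = q powr (- \<alpha> / ?n) * young_inverse \<Phi> q"
            using q by (simp add: powr_divide powr_minus_divide)
          also have "\<dots> \<le> C * p"
            unfolding p_def by (rule C(2)[OF q])
          also have "\<dots> \<le> 4 * C * p"
            using C p by simp
          finally show thesis
            using that[of m] m avg[OF r] by (simp add: V_def)
        next
          case False
          define s where "s = 1 / V"
          have s: "0 < s" "s \<le> q" using V False by (auto simp: s_def)
          have sV: "s * V = 1" using V by (simp add: s_def)
          have "(\<integral>\<^sup>+ y\<in>ball c r. \<Phi> \<bar>f y\<bar> \<partial>lebesgue) \<le> (\<integral>\<^sup>+ y. \<Phi> \<bar>f y\<bar> \<partial>lebesgue)"
            by (intro nn_integral_mono) (auto split: split_indicator)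
          also have "\<dots> \<le> ennreal (s * V)"
            using f1 by (simp add: sV)
          finally have le: "(\<integral>\<^sup>+ y\<in>ball c r. ennreal \<bar>f y\<bar> \<partial>lebesgue) \<le> ennreal (4 * young_inverse \<Phi> s * V)"
            unfolding V_def using s by (intro ball_integral_le_young_inverse[OF Y]) auto
          have "V powr (\<alpha> / ?n) * (4 * young_inverse \<Phi> s) = 4 * (s powr (- \<alpha> / ?n) * young_inverse \<Phi> s)"
            using V by (simp add: s_def powr_divide powr_minus_divide)
          also have "\<dots> \<le> 4 * (C * young_inverse \<Psi> s)"
            using C(2)[OF s(1)] by simp
          also have "\<dots> \<le> 4 * (C * p)"
            unfolding p_def using C s by (intro mult_left_mono young_inverse_mono[OF \<Psi>]) auto
          finally show thesis
            using that[of "4 * young_inverse \<Phi> s"] le young_inverse_pos[OF Y'(1) s(1)] by simp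
        qed
        have "ennreal (V powr (- 1 + \<alpha> / ?n)) * (\<integral>\<^sup>+ y\<in>ball c r. ennreal \<bar>f y\<bar> \<partial>lebesgue)
            \<le> ennreal (V powr (- 1 + \<alpha> / ?n)) * ennreal (u * V)"
          by (intro mult_left_mono u) auto
        also have "\<dots> = ennreal (V powr (\<alpha> / ?n - 1) * V * u)"
          using u V by (simp add: ennreal_mult[symmetric] mult_ac)
        also have "\<dots> = ennreal (V powr (\<alpha> / ?n) * u)"
          using V by (simp only: powr_average)
        also have "\<dots> \<le> ennreal (4 * C * p)"
          by (intro ennreal_leI u)
        finally show ?thesis .
      qed
      then show "ennreal (measure lebesgue (ball c r) powr (- 1 + \<alpha> / ?n)) *
          (\<integral>\<^sup>+ y\<in>ball c r. ennreal \<bar>f y\<bar> \<partial>lebesgue) \<le> ennreal (4 * C * p)"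
        by (simp add: V_def)
    qed
    then have "enn2real (frac_maximal \<alpha> f x) \<le> 4 * C * p"
      using C p by (simp add: enn2real_leI)
    \<comment> \<open>Doubling the constant \<open>4 * C\<close> places the argument strictly below
      the inverse.\<close>
    then have "enn2real (frac_maximal \<alpha> f x) / (8 * C) \<le> p / 2"
      using C by (simp add: field_simps)
    also have "\<dots> < young_inverse \<Psi> q"
      using p by (simp add: p_def)
    finally have "\<Psi> (enn2real (frac_maximal \<alpha> f x) / (8 * C)) \<le> ennreal q"
      using C by (intro young_le_of_less_inverse) auto
    then show ?thesis
      by (simp add: q' m_def[symmetric])
  qed
qed

lemma orlicz_bounded:
  assumes Y: "\<Phi> \<in> young_class_Y" and \<Psi>: "young_function \<Psi>" and nabla: "nabla2 \<Phi>"
    and \<alpha>: "0 < \<alpha>" "\<alpha> < real DIM('a::euclidean_space)"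
    and C: "0 < C" "\<And>r. 0 < r \<Longrightarrow>
      r powr (- \<alpha> / real DIM('a)) * young_inverse \<Phi> r \<le> C * young_inverse \<Psi> r"
  shows "bounded_operator (orlicz_space \<Phi> :: ('a \<Rightarrow> real) set) (orlicz_norm \<Phi>)
           (orlicz_space \<Psi>) (orlicz_norm \<Psi>) (frac_maximal \<alpha>)"
proof -
  note Y' = young_class_Y_D[OF Y]
  obtain a where a: "1 < a" "\<And>r. 0 \<le> r \<Longrightarrow> \<Phi> r \<le> ennreal (1 / (2 * a)) * \<Phi> (a * r)"
    using nabla unfolding nabla2_def by blast
  define L where "L = 2 * a * 5 ^ DIM('a)"
  have L: "1 \<le> L"
  proof -
    have "1 * 1 \<le> (2 * a) * 5 ^ DIM('a)"
      using a by (intro mult_mono) auto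
    then show ?thesis by (simp add: L_def)
  qed
  \<comment> \<open>\<open>8 * C\<close> comes from the pointwise comparison, \<open>2 * a\<close>
    offsets the dilation inside the modular estimate for the maximal function, and \<open>L\<close>
    offsets its constant.\<close>
  define K where "K = 8 * C * (2 * a * L)"
  have K: "0 < K" using a L C by (simp add: K_def)
  have admissible: "(\<integral>\<^sup>+ x. \<Psi> (\<bar>enn2real (frac_maximal \<alpha> f x)\<bar> / (K * \<mu>)) \<partial>lebesgue) \<le> 1"
    if [measurable]: "f \<in> borel_measurable lebesgue"
      and \<mu>: "0 < \<mu>" "(\<integral>\<^sup>+ x. \<Phi> (\<bar>f x\<bar> / \<mu>) \<partial>lebesgue) \<le> 1" for f :: "'a \<Rightarrow> real" and \<mu>
  proof -
    define k where "k = 1 / (2 * a * L * \<mu>)"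
    have k: "0 < k" using a L \<mu> by (simp add: k_def)
    define h where "h x = k * f x" for x
    have [measurable]: "h \<in> borel_measurable lebesgue"
      unfolding h_def by measurable
    have "(\<integral>\<^sup>+ x. \<Phi> (2 * a * \<bar>h x\<bar>) \<partial>lebesgue) = (\<integral>\<^sup>+ x. \<Phi> (1 / L * \<bar>f x / \<mu>\<bar>) \<partial>lebesgue)"
      using a L \<mu> by (intro nn_integral_cong arg_cong[where f = \<Phi>]) (simp add: h_def k_def abs_mult)
    also have "\<dots> \<le> ennreal (1 / L) * (\<integral>\<^sup>+ x. \<Phi> \<bar>f x / \<mu>\<bar> \<partial>lebesgue)"
      using L by (intro young_modular_scale[OF Y]) auto
    also have "\<dots> \<le> ennreal (1 / L) * 1"
      using \<mu> by (intro mult_left_mono) auto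
    finally have h: "(\<integral>\<^sup>+ x. \<Phi> (2 * a * \<bar>h x\<bar>) \<partial>lebesgue) \<le> ennreal (1 / L)"
      by simp
    have "(\<integral>\<^sup>+ x. \<Phi> \<bar>h x\<bar> \<partial>lebesgue) \<le> (\<integral>\<^sup>+ x. \<Phi> (2 * a * \<bar>h x\<bar>) \<partial>lebesgue)"
      using a by (intro nn_integral_mono young_mono Y') (auto simp: mult_le_cancel_right1)
    also note h
    also have "ennreal (1 / L) \<le> 1" using L by simp
    finally have h1: "(\<integral>\<^sup>+ x. \<Phi> \<bar>h x\<bar> \<partial>lebesgue) \<le> 1" .
    \<comment> \<open>Finiteness is obtained with \<alpha> = 0, target \<Phi> itself and constant 1,
      for which the condition is trivial.\<close>
    have "AE x in lebesgue. frac_maximal 0 h x < \<infinity>"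
      using h1 by (intro frac_maximal_AE_finite[OF Y Y'(1), of 0 1 h 1]) auto
    then have "AE x in lebesgue. \<Psi> (\<bar>enn2real (frac_maximal \<alpha> f x)\<bar> / (K * \<mu>)) \<le> \<Phi> (enn2real (frac_maximal 0 h x))"
    proof eventually_elim
      case (elim x)
      have "frac_maximal \<alpha> h x = ennreal k * frac_maximal \<alpha> f x"
        unfolding h_def using k by (intro frac_maximal_cmult) auto
      then have "enn2real (frac_maximal \<alpha> h x) / (8 * C) = \<bar>enn2real (frac_maximal \<alpha> f x)\<bar> / (K * \<mu>)"
        using k by (simp add: enn2real_mult) (simp add: k_def K_def)
      moreover have "\<Psi> (enn2real (frac_maximal \<alpha> h x) / (8 * C)) \<le> \<Phi> (enn2real (frac_maximal 0 h x))"
        using \<alpha> C h1 elim by (intro frac_maximal_pointwise[OF Y \<Psi>]) auto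
      ultimately show ?case by simp
    qed
    then have "(\<integral>\<^sup>+ x. \<Psi> (\<bar>enn2real (frac_maximal \<alpha> f x)\<bar> / (K * \<mu>)) \<partial>lebesgue)
        \<le> (\<integral>\<^sup>+ x. \<Phi> (enn2real (frac_maximal 0 h x)) \<partial>lebesgue)"
      by (rule nn_integral_mono_AE)
    also have "\<dots> \<le> ennreal L * (\<integral>\<^sup>+ x. \<Phi> (2 * a * \<bar>h x\<bar>) \<partial>lebesgue)"
      unfolding L_def by (intro maximal_modular[OF Y a]) auto
    also have "\<dots> \<le> ennreal L * ennreal (1 / L)"
      by (intro mult_left_mono h) auto
    also have "\<dots> = 1"
      using L by (simp add: ennreal_mult[symmetric])
    finally show ?thesis .
  qed
  \<comment> \<open>Provides almost-everywhere finiteness and local integrability of the image; only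
    the norm estimate is specific to the strong type.\<close>
  have weak: "bounded_operator (orlicz_space \<Phi> :: ('a \<Rightarrow> real) set) (orlicz_norm \<Phi>)
           (weak_orlicz_space \<Psi>) (weak_orlicz_norm \<Psi>) (frac_maximal \<alpha>)"
    by (rule weak_orlicz_bounded[OF Y \<Psi> \<alpha> C])
  show ?thesis
    unfolding bounded_operator_def
  proof (intro exI[of _ K] conjI ballI K)
    fix f :: "'a \<Rightarrow> real" assume f: "f \<in> orlicz_space \<Phi>"
    then have [measurable]: "f \<in> borel_measurable lebesgue"
      by (intro L1_loc_measurable) (simp add: orlicz_space_def)
    show "AE x in lebesgue. frac_maximal \<alpha> f x < \<infinity>"
      using weak f unfolding bounded_operator_def by blast
    obtain \<mu> where \<mu>: "0 < \<mu>" "(\<integral>\<^sup>+ x. \<Phi> (\<bar>f x\<bar> / \<mu>) \<partial>lebesgue) \<le> 1"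
      using orlicz_space_admissible[OF Y f] .
    have "(\<integral>\<^sup>+ x. \<Psi> (1 / (K * \<mu>) * \<bar>enn2real (frac_maximal \<alpha> f x)\<bar>) \<partial>lebesgue) < \<infinity>"
      using admissible[OF _ \<mu>] by (auto intro: le_less_trans)
    moreover have "(\<lambda>x. enn2real (frac_maximal \<alpha> f x)) \<in> L1_loc"
      using weak f unfolding bounded_operator_def weak_orlicz_space_def by blast
    ultimately show "(\<lambda>x. enn2real (frac_maximal \<alpha> f x)) \<in> orlicz_space \<Psi>"
      unfolding orlicz_space_def using K \<mu> by (intro CollectI conjI exI[of _ "1 / (K * \<mu>)"]) auto
    show "orlicz_norm \<Psi> (\<lambda>x. enn2real (frac_maximal \<alpha> f x)) \<le> ennreal K * orlicz_norm \<Phi> f"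
      unfolding orlicz_norm_def using admissible by (intro Inf_ennreal_scale K) auto
  qed
qed

section \<open>Both equivalences on \<open>real ^ 'n\<close>\<close>

theorem theorem3p4:
  fixes \<alpha> :: real and \<Phi> \<Psi> :: "real \<Rightarrow> ennreal"
  assumes "0 < \<alpha>" and "\<alpha> < real CARD('n::finite)"
    and "young_function \<Phi>" and "young_function \<Psi>"
    and "\<Phi> \<in> young_class_Y"
  shows "((\<exists>C>0. \<forall>r>0. r powr (- \<alpha> / real CARD('n)) * young_inverse \<Phi> r
              \<le> C * young_inverse \<Psi> r) \<longleftrightarrow>
         bounded_operator (orlicz_space \<Phi> :: (real ^ 'n \<Rightarrow> real) set) (orlicz_norm \<Phi>)
           (weak_orlicz_space \<Psi>) (weak_orlicz_norm \<Psi>) (frac_maximal \<alpha>)) \<and>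
        (nabla2 \<Phi> \<longrightarrow>
        ((\<exists>C>0. \<forall>r>0. r powr (- \<alpha> / real CARD('n)) * young_inverse \<Phi> r
              \<le> C * young_inverse \<Psi> r) \<longleftrightarrow>
         bounded_operator (orlicz_space \<Phi> :: (real ^ 'n \<Rightarrow> real) set) (orlicz_norm \<Phi>)
           (orlicz_space \<Psi>) (orlicz_norm \<Psi>) (frac_maximal \<alpha>)))"
proof -
  have dim: "DIM(real ^ 'n) = CARD('n)" by simp
  note necessity = weak_orlicz_bounded_imp_inverse_le[where 'a = "real ^ 'n", OF assms(5,4), unfolded dim]
  note weak = weak_orlicz_bounded[where 'a = "real ^ 'n", OF assms(5,4) assms(1), unfolded dim, OF assms(2)]
  note strong = orlicz_bounded[where 'a = "real ^ 'n", OF assms(5,4) _ assms(1), unfolded dim, OF _ assms(2)]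
  note imp_weak = bounded_operator_orlicz_imp_weak[where 'a = "real ^ 'n", OF assms(5,4)]
  show ?thesis
    using necessity weak strong imp_weak by blast
qed

end
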